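(* Consider the random model with $n$ men, $n$ women, independent uniformly random complete preference lists, and independent admissibility of each pair with probability $p=p(n)\in(0,1)$, where $p(n)\ge c\,\frac{\log^2 n}{n}$ with a constant $c>\frac94$. Let $\mathcal Q_n^{(-)}$ be the smallest total rank of wives over all (possibly partial) stable matchings. Then for every constant $\varepsilon\in(0,1)$, $$\mathbb{P}\bigl(\mathcal Q_n^{(-)}\ge(1-\varepsilon)\,n\log n\bigr)\to 1\qquad(n\to\infty).$$
   Context: Model. There are $n$ men and $n$ women. Each man has a preference list which is a permutation (strict linear order) of all $n$ women, and each woman has a preference list which is a permutation of all $n$ men; the $2n$ lists are independent and uniformly random. Independently of the lists, each of the $n^2$ pairs (man, woman) is admissible with probability $p=p(n)$, independently of all other pairs. A (possibly partial) matching $M$ is a set of pairwise disjoint admissible pairs (man, woman). It is called stable if there is no admissible pair $(m,w)\notin M$ such that both: $m$ is unmatched in $M$ or prefers $w$ to his partner in $M$; and $w$ is unmatched in $M$ or prefers $m$ to her partner in $M$. A stable matching always exists. For a stable matching $M$ and a man $m$ matched in $M$ to $w$, the rank of his wife $w$ is $1$ plus the number of women $w'$ such that $(m,w')$ is admissible and $m$ prefers $w'$ to $w$. The total rank of wives in $M$, $Q(M)$, is the sum of these ranks over all men matched in $M$. $\mathcal Q_n^{(-)}$ is the minimum of $Q(M)$ over all stable matchings $M$ of the instance. Inequalities on $p(n)$ are understood to hold for all sufficiently large $n$; $\log$ is the natural logarithm. *)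

theory Defs
  imports "HOL-Probability.Probability" "HOL-Combinatorics.Multiset_Permutations"
begin

text \<open>
  Men and women are both numbered by \<open>{..<n}\<close>; a pair \<open>(m, w)\<close> always lists the man first.
  A preference list is a permutation of \<open>{..<n}\<close>, most preferred partner first.
\<close>

type_synonym prefs = "nat \<Rightarrow> nat list"

type_synonym smp_instance = "prefs \<times> prefs \<times> (nat \<times> nat \<Rightarrow> bool)"

definition prefers :: "nat list \<Rightarrow> nat \<Rightarrow> nat \<Rightarrow> bool" where
  "prefers xs a b \<longleftrightarrow> (\<exists>i j. i < j \<and> j < length xs \<and> xs ! i = a \<and> xs ! j = b)"

fun admissible_pairs :: "nat \<Rightarrow> smp_instance \<Rightarrow> (nat \<times> nat) set" where
  "admissible_pairs n (mp, wp, adm) = {e \<in> {..<n} \<times> {..<n}. adm e}"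

definition is_matching :: "nat \<Rightarrow> smp_instance \<Rightarrow> (nat \<times> nat) set \<Rightarrow> bool" where
  "is_matching n I M \<longleftrightarrow>
     M \<subseteq> admissible_pairs n I \<and>
     (\<forall>(m, w) \<in> M. \<forall>(m', w') \<in> M. (m, w) \<noteq> (m', w') \<longrightarrow> m \<noteq> m' \<and> w \<noteq> w')"

fun blocking_pair :: "nat \<Rightarrow> smp_instance \<Rightarrow> (nat \<times> nat) set \<Rightarrow> nat \<Rightarrow> nat \<Rightarrow> bool" where
  "blocking_pair n (mp, wp, adm) M m w \<longleftrightarrow>
     (m, w) \<in> admissible_pairs n (mp, wp, adm) \<and> (m, w) \<notin> M \<and>
     (m \<notin> Domain M \<or> (\<exists>w'. (m, w') \<in> M \<and> prefers (mp m) w w')) \<and>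
     (w \<notin> Range M \<or> (\<exists>m'. (m', w) \<in> M \<and> prefers (wp w) m m'))"

definition stable_matching :: "nat \<Rightarrow> smp_instance \<Rightarrow> (nat \<times> nat) set \<Rightarrow> bool" where
  "stable_matching n I M \<longleftrightarrow> is_matching n I M \<and> (\<nexists>m w. blocking_pair n I M m w)"

fun wife_rank :: "nat \<Rightarrow> smp_instance \<Rightarrow> nat \<Rightarrow> nat \<Rightarrow> nat" where
  "wife_rank n (mp, wp, adm) m w =
     1 + card {w'. (m, w') \<in> admissible_pairs n (mp, wp, adm) \<and> prefers (mp m) w' w}"

definition total_wife_rank :: "nat \<Rightarrow> smp_instance \<Rightarrow> (nat \<times> nat) set \<Rightarrow> nat" where
  "total_wife_rank n I M = (\<Sum>(m, w) \<in> M. wife_rank n I m w)"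

text \<open>
  The minimum is over a finite set, since matchings are subsets of \<open>{..<n} \<times> {..<n}\<close>; by
  Gale and Shapley the set is nonempty whenever the lists are permutations of \<open>{..<n}\<close>,
  which holds on the support of \<open>random_instance\<close> below.
\<close>

definition min_total_wife_rank :: "nat \<Rightarrow> smp_instance \<Rightarrow> nat" where
  "min_total_wife_rank n I = Min (total_wife_rank n I ` {M. stable_matching n I M})"

definition random_prefs :: "nat \<Rightarrow> prefs pmf" where
  "random_prefs n = Pi_pmf {..<n} [] (\<lambda>_. pmf_of_set (permutations_of_set {..<n}))"

text \<open>
  The default values of \<open>Pi_pmf\<close> (\<open>[]\<close> above, \<open>False\<close> here) only concern indices outside the model.
\<close>

definition random_admissibility :: "nat \<Rightarrow> real \<Rightarrow> (nat \<times> nat \<Rightarrow> bool) pmf" where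
  "random_admissibility n p = Pi_pmf ({..<n} \<times> {..<n}) False (\<lambda>_. bernoulli_pmf p)"

definition random_instance :: "nat \<Rightarrow> real \<Rightarrow> smp_instance pmf" where
  "random_instance n p =
     pair_pmf (random_prefs n) (pair_pmf (random_prefs n) (random_admissibility n p))"

end

theory Submission
  imports Defs "HOL-Real_Asymp.Real_Asymp"
begin

text \<open>
  First moment method over all stable matchings, perfect or not. Given a uniform \<open>x\<^sub>m \<in> [0, 1]\<close> for each
  matched man and \<open>y\<^sub>w\<close> for each matched woman, a person's list behaves as if every potential partner
  were preferred to the actual one independently with that probability. With \<open>z = 1 - ln n / n\<close>, this
  writes the expectation of \<open>z\<^sup>Q\<close> on the event that a given matching with \<open>k = n - l\<close> pairs is stable as an
  integral over the cube. Integrating out the \<open>y\<^sub>w\<close> leaves a function of \<open>u = p (x\<^sub>1 + \<dots> + x\<^sub>k)\<close>; with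
  \<open>t = u + p l\<close> it is essentially
  \<open>p\<^sup>k exp (u - k u ln n / n - l t) ((1 - exp (- t)) / t)\<^sup>k\<close>. There are
  \<open>(n choose k)\<^sup>2 k!\<close> matchings of size \<open>k\<close>, and the sum is small: if \<open>l\<close> is
  of order \<open>n\<close> then \<open>exp (- l t)\<close> wins; otherwise, if \<open>t\<close> is below
  \<open>(1 - \<epsilon>/2) ln n\<close> then \<open>(1 - exp (- t))\<^sup>k\<close> is tiny, if \<open>u\<close> is above \<open>(1 - 3\<epsilon>/4) ln n\<close> then the factor
  from \<open>z\<^sup>Q\<close> wins, and in the remaining case \<open>(u / t)\<^sup>k\<close> is exponentially small.
\<close>

section \<open>Existence of stable matchings\<close>

text \<open>The position in the list serves as a rank that is injective on persons. Comparisons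
  become \<open><\<close> on natural numbers, so a best partner can be picked by
  \<open>arg_min\<close>.\<close>

lemma prefers_permutation:
  assumes "xs \<in> permutations_of_set {..<n}" 
  obtains r where "inj_on r {..<n}" "\<And>a b. prefers xs a b \<longleftrightarrow> a < n \<and> b < n \<and> r a < (r b :: nat)"
proof -
  from assms have d: "distinct xs" and s: "set xs = {..<n}"
    by (auto dest: permutations_of_setD)
  define r where "r a = (THE i. i < length xs \<and> xs ! i = a)" for a
  have r: "r a < length xs \<and> xs ! r a = a" if "a < n" for a
  proof -
    have "\<exists>!i. i < length xs \<and> xs ! i = a"
      using that s d by (metis distinct_Ex1 lessThan_iff)
    from theI'[OF this] show ?thesis unfolding r_def .
  qed
  have r': "r (xs ! i) = i" if "i < length xs" for i
    using r[of "xs ! i"] that s d by (metis lessThan_iff nth_eq_iff_index_eq nth_mem)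
  have "inj_on r {..<n}" by (metis inj_onI lessThan_iff r)
  moreover have "prefers xs a b \<longleftrightarrow> a < n \<and> b < n \<and> r a < r b" for a b
  proof
    assume "prefers xs a b"
    then obtain i j where "i < j" "j < length xs" "xs ! i = a" "xs ! j = b"
      unfolding prefers_def by auto
    then show "a < n \<and> b < n \<and> r a < r b"
      using r' s by (metis lessThan_iff nth_mem order.strict_trans)
  next
    assume "a < n \<and> b < n \<and> r a < r b"
    then show "prefers xs a b" unfolding prefers_def using r by blast
  qed
  ultimately show ?thesis using that by blast
qed

lemma prefers_irrefl: "distinct xs \<Longrightarrow> \<not> prefers xs a a"
  unfolding prefers_def using nth_eq_iff_index_eq by fastforce

text \<open>Makes the minimum in \<open>min_total_wife_rank\<close> one over a nonempty set, so that
  it is attained by some stable matching, to which the union bound can then be applied.\<close>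

lemma stable_matching_exists:
  assumes "\<And>m. m < n \<Longrightarrow> mp m \<in> permutations_of_set {..<n}"
    and "\<And>w. w < n \<Longrightarrow> wp w \<in> permutations_of_set {..<n}"
  shows "\<exists>M. stable_matching n (mp, wp, adm) M"
proof -
  define A where "A = admissible_pairs n (mp, wp, adm)"
  have A: "m < n \<and> w < n" if "(m, w) \<in> A" for m w
    using that unfolding A_def by auto
  have "\<exists>r. inj_on r {..<n} \<and> (\<forall>a b. prefers (mp m) a b \<longleftrightarrow> a < n \<and> b < n \<and> r a < (r b :: nat))"
    if "m < n" for m
    using prefers_permutation[OF assms(1)[OF that]] by metis
  then obtain rm where rm: "\<And>m. m < n \<Longrightarrow> inj_on (rm m) {..<n}"
    "\<And>m a b. m < n \<Longrightarrow> prefers (mp m) a b \<longleftrightarrow> a < n \<and> b < n \<and> rm m a < (rm m b :: nat)"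
    by metis
  have "\<exists>r. inj_on r {..<n} \<and> (\<forall>a b. prefers (wp w) a b \<longleftrightarrow> a < n \<and> b < n \<and> r a < (r b :: nat))"
    if "w < n" for w
    using prefers_permutation[OF assms(2)[OF that]] by metis
  then obtain rw where rw: "\<And>w. w < n \<Longrightarrow> inj_on (rw w) {..<n}"
    "\<And>w a b. w < n \<Longrightarrow> prefers (wp w) a b \<longleftrightarrow> a < n \<and> b < n \<and> rw w a < (rw w b :: nat)"
    by metis
  txt \<open>
    If \<open>X\<close> is the set of pairs open to the men and \<open>Y\<close> the set open to the women, the rejections
    \<open>RM X\<close> and \<open>RW Y\<close> are monotone, so Tarski yields \<open>X = A - RW Y\<close>, \<open>Y = A - RM X\<close>; then \<open>X \<inter> Y\<close> is stable.
  \<close>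
  define RM where "RM X = {(m, w) \<in> X. \<exists>w'. (m, w') \<in> X \<and> prefers (mp m) w' w}" for X
  define RW where "RW Y = {(m, w) \<in> Y. \<exists>m'. (m', w) \<in> Y \<and> prefers (wp w) m' m}" for Y
  define F where "F X = A - RW (A - RM X)" for X
  have rej_mono: "RM X \<subseteq> RM X'" "RW X \<subseteq> RW X'" if "X \<subseteq> X'" for X X'
    using that unfolding RM_def RW_def by auto
  have "mono F"
    unfolding F_def by (intro monoI Diff_mono order_refl rej_mono)
  define X where "X = lfp F"
  have Xfix: "X = F X" unfolding X_def by (rule lfp_unfold[OF \<open>mono F\<close>])
  define Y where "Y = A - RM X"
  have X: "X = A - RW Y"
    using Xfix unfolding F_def Y_def .
  have XA: "X \<subseteq> A" by (subst X) (rule Diff_subset)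
  have YA: "Y \<subseteq> A" unfolding Y_def by (rule Diff_subset)
  have RMX: "RM X \<subseteq> X" and RWY: "RW Y \<subseteq> Y" unfolding RM_def RW_def by auto
  define M where "M = X \<inter> Y"
  have M1: "M = X - RM X" unfolding M_def Y_def using XA by auto
  have M2: "M = Y - RW Y" unfolding M_def by (subst X) (use YA in auto)
  \<comment> \<open>An admissible pair rejected by neither side lies in \<open>X\<close> and in
    \<open>Y\<close> by the two fixpoint equations, hence in \<open>M\<close>.\<close>
  have cover: "e \<in> M \<or> e \<in> RM X \<or> e \<in> RW Y" if "e \<in> A" for e
    using that equalityD2[OF X] unfolding Y_def M_def by blast
  \<comment> \<open>The woman ranked first by \<open>m\<close> among his pairs in \<open>X\<close>
    cannot be rejected by him, so this pair survives in \<open>M\<close> and beats the rejected one.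
    The women's case below is symmetric.\<close>
  have best_m: "\<exists>w'. (m, w') \<in> M \<and> prefers (mp m) w' w" if "(m, w) \<in> RM X" for m w
  proof -
    from that have mw: "(m, w) \<in> X" unfolding RM_def by auto
    define w' where "w' = arg_min (rm m) (\<lambda>w'. (m, w') \<in> X)"
    have w': "(m, w') \<in> X" and min: "\<And>v. (m, v) \<in> X \<Longrightarrow> rm m w' \<le> rm m v"
      unfolding w'_def using arg_min_nat_lemma[of "\<lambda>w'. (m, w') \<in> X" w "rm m"] mw by auto
    have n: "m < n" "w < n" "w' < n" using A XA mw w' by auto
    have "(m, w') \<notin> RM X"
      unfolding RM_def using min rm(2)[OF n(1)] by fastforce
    moreover from this that have "w \<noteq> w'" by auto
    then have "rm m w' \<noteq> rm m w" using rm(1)[OF n(1)] n by (auto dest: inj_onD)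
    ultimately show ?thesis
      using M1 w' rm(2)[OF n(1)] n min[OF mw] by (intro exI[of _ w']) auto
  qed
  have best_w: "\<exists>m'. (m', w) \<in> M \<and> prefers (wp w) m' m" if "(m, w) \<in> RW Y" for m w
  proof -
    from that have mw: "(m, w) \<in> Y" unfolding RW_def by auto
    define m' where "m' = arg_min (rw w) (\<lambda>m'. (m', w) \<in> Y)"
    have m': "(m', w) \<in> Y" and min: "\<And>v. (v, w) \<in> Y \<Longrightarrow> rw w m' \<le> rw w v"
      unfolding m'_def using arg_min_nat_lemma[of "\<lambda>m'. (m', w) \<in> Y" m "rw w"] mw by auto
    have n: "m < n" "w < n" "m' < n" using A YA mw m' by auto
    have "(m', w) \<notin> RW Y"
      unfolding RW_def using min rw(2)[OF n(2)] by fastforce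
    moreover from this that have "m \<noteq> m'" by auto
    then have "rw w m' \<noteq> rw w m" using rw(1)[OF n(2)] n by (auto dest: inj_onD)
    ultimately show ?thesis
      using M2 m' rw(2)[OF n(2)] n min[OF mw] by (intro exI[of _ m']) auto
  qed
  have um: "w = w'" if "(m, w) \<in> M" "(m, w') \<in> M" for m w w'
  proof (rule ccontr)
    assume "w \<noteq> w'"
    have n: "m < n" "w < n" "w' < n" using that A XA M1 by auto
    have "rm m w \<noteq> rm m w'" using \<open>w \<noteq> w'\<close> rm(1)[OF n(1)] n by (auto dest: inj_onD)
    then have "prefers (mp m) w w' \<or> prefers (mp m) w' w" using rm(2)[OF n(1)] n by auto
    then show False using that unfolding M1 RM_def by auto
  qed
  have uw: "m = m'" if "(m, w) \<in> M" "(m', w) \<in> M" for m m' w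
  proof (rule ccontr)
    assume "m \<noteq> m'"
    have n: "m < n" "w < n" "m' < n" using that A XA M1 by auto
    have "rw w m \<noteq> rw w m'" using \<open>m \<noteq> m'\<close> rw(1)[OF n(2)] n by (auto dest: inj_onD)
    then have "prefers (wp w) m m' \<or> prefers (wp w) m' m" using rw(2)[OF n(2)] n by auto
    then show False using that unfolding M2 RW_def by auto
  qed
  have "M \<subseteq> admissible_pairs n (mp, wp, adm)"
    using XA M1 unfolding A_def by blast
  then have "is_matching n (mp, wp, adm) M"
    unfolding is_matching_def by (auto dest: um uw)
  moreover have "\<not> blocking_pair n (mp, wp, adm) M m w" for m w
  proof
    assume b: "blocking_pair n (mp, wp, adm) M m w"
    then have "(m, w) \<in> A" "(m, w) \<notin> M" unfolding A_def by simp_all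
    \<comment> \<open>A pair outside \<open>M\<close> was rejected by one of its members, who holds
      a partner in \<open>M\<close> ranked above the other member. Uniqueness of that partner
      contradicts blocking.\<close>
    then consider "(m, w) \<in> RM X" | "(m, w) \<in> RW Y" using cover by blast
    then show False
    proof cases
      case 1
      from best_m[OF this] obtain w1 where w1: "(m, w1) \<in> M" "prefers (mp m) w1 w" by blast
      then have "m \<in> Domain M" by blast
      with b obtain w2 where "(m, w2) \<in> M" "prefers (mp m) w w2" by auto
      with w1 um have "prefers (mp m) w w1" by blast
      then show False using w1 rm(2) A \<open>(m, w) \<in> A\<close> by force
    next
      case 2
      from best_w[OF this] obtain m1 where m1: "(m1, w) \<in> M" "prefers (wp w) m1 m" by blast
      then have "w \<in> Range M" by blast
      with b obtain m2 where "(m2, w) \<in> M" "prefers (wp w) m m2" by auto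
      with m1 uw have "prefers (wp w) m m1" by blast
      then show False using m1 rw(2) A \<open>(m, w) \<in> A\<close> by force
    qed
  qed
  ultimately show ?thesis unfolding stable_matching_def by blast
qed

section \<open>Uniform permutations as mixtures of independent choices\<close>

text \<open>The value \<open>a! b! / (a + b + 1)!\<close> is also the probability that a prescribed
  set of \<open>a\<close> elements is exactly what precedes a given element in a random permutation
  of \<open>a + b + 1\<close> elements. This coincidence is the source of the mixture
  representation.\<close>

lemma nn_integral_Beta_nat:
  "(\<integral>\<^sup>+x. ennreal (x ^ a * (1 - x) ^ b) \<partial>restrict_space lborel {0..1::real}) =
     ennreal (fact a * fact b / fact (a + b + 1))"
proof -
  have "((\<lambda>t. t powr (real a + 1 - 1) * (1 - t) powr (real b + 1 - 1)) has_integral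
      Beta (real a + 1) (real b + 1)) {0..1::real}"
    by (rule has_integral_Beta_real) auto
  also have "Beta (real a + 1) (real b + 1) = fact a * fact b / fact (a + b + 1)"
    unfolding Beta_def using Gamma_fact[of a, where 'a = real] Gamma_fact[of b, where 'a = real]
      Gamma_fact[of "a + b + 1", where 'a = real]
    by (simp add: add_ac)
  finally have "((\<lambda>t. t powr real a * (1 - t) powr real b) has_integral
      fact a * fact b / fact (a + b + 1)) {0..1::real}" by simp
  \<comment> \<open>The endpoints are removed before passing from \<open>powr\<close> to powers,
    because \<open>0 powr 0 = 0\<close> while \<open>0 ^ 0 = 1\<close>.\<close>
  then have "((\<lambda>t. t powr real a * (1 - t) powr real b) has_integral
      fact a * fact b / fact (a + b + 1)) {0<..<1::real}"
    by (simp add: has_integral_Icc_iff_Ioo)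
  then have "((\<lambda>t. t ^ a * (1 - t) ^ b) has_integral
      fact a * fact b / fact (a + b + 1)) {0<..<1::real}"
    by (rule has_integral_eq[rotated]) (auto simp: powr_realpow)
  then have I: "((\<lambda>t. t ^ a * (1 - t) ^ b) has_integral
      fact a * fact b / fact (a + b + 1)) {0..1::real}"
    by (simp add: has_integral_Icc_iff_Ioo)
  have "(\<integral>\<^sup>+x. ennreal (x ^ a * (1 - x) ^ b) \<partial>restrict_space lborel {0..1::real}) =
    (\<integral>\<^sup>+x. ennreal (x ^ a * (1 - x) ^ b) * indicator {0..1} x \<partial>lborel)"
    by (subst nn_integral_restrict_space) auto
  also have "\<dots> = ennreal (fact a * fact b / fact (a + b + 1))"
    by (rule nn_integral_has_integral_lebesgue'[OF _ I]) auto
  finally show ?thesis .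
qed

text \<open>Such a permutation is an arrangement of \<open>S\<close>, then \<open>w\<close>, then an
  arrangement of the rest. The concatenation map \<open>f\<close> is a bijection from the pairs of
  arrangements.\<close>

lemma card_permutations_split_at:
  assumes "finite A" "w \<in> A" "S \<subseteq> A - {w}"
  shows "card {xs \<in> permutations_of_set A. {v \<in> A - {w}. prefers xs v w} = S}
    = fact (card S) * fact (card A - 1 - card S)"
proof -
  define Tl where "Tl = A - {w} - S"
  define f where "f = (\<lambda>(ys, zs). ys @ w # zs)"
  let ?P = "permutations_of_set S \<times> permutations_of_set Tl"
  have pref: "{v \<in> A - {w}. prefers (ys @ w # zs) v w} = set ys"
    if "distinct (ys @ w # zs)" "set (ys @ w # zs) = A" for ys zs
  proof -
    have "prefers (ys @ w # zs) v w \<longleftrightarrow> v \<in> set ys" for v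
    proof
      assume "prefers (ys @ w # zs) v w"
      then obtain i j where ij: "i < j" "j < length (ys @ w # zs)" "(ys @ w # zs) ! i = v"
        "(ys @ w # zs) ! j = w" unfolding prefers_def by blast
      have "(ys @ w # zs) ! length ys = w" by simp
      then have "j = length ys"
        using ij that(1) nth_eq_iff_index_eq[OF that(1), of j "length ys"] by simp
      then show "v \<in> set ys" using ij by (auto simp: nth_append)
    next
      assume "v \<in> set ys"
      then obtain i where "i < length ys" "ys ! i = v" by (auto simp: in_set_conv_nth)
      then show "prefers (ys @ w # zs) v w"
        unfolding prefers_def by (intro exI[of _ i] exI[of _ "length ys"]) (auto simp: nth_append)
    qed
    then show ?thesis using that by auto
  qed
  have "bij_betw f ?P {xs \<in> permutations_of_set A. {v \<in> A - {w}. prefers xs v w} = S}"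
    unfolding bij_betw_def
  proof
    show "inj_on f ?P"
      unfolding inj_on_def f_def
    proof (clarsimp)
      fix ys zs ys' zs'
      assume *: "ys \<in> permutations_of_set S" "ys' \<in> permutations_of_set S"
        "ys @ w # zs = ys' @ w # zs'"
      have "length ys = length ys'"
        using * by (simp add: length_finite_permutations_of_set)
      with * show "ys = ys' \<and> zs = zs'" by simp
    qed
    show "f ` ?P = {xs \<in> permutations_of_set A. {v \<in> A - {w}. prefers xs v w} = S}"
    proof (intro equalityI subsetI)
      fix xs assume "xs \<in> f ` ?P"
      then obtain ys zs where xs: "xs = ys @ w # zs" and
        s: "set ys = S" "distinct ys" "set zs = Tl" "distinct zs"
        unfolding f_def permutations_of_set_def by auto
      have "distinct xs" "set xs = A" unfolding xs using s assms unfolding Tl_def by auto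
      then show "xs \<in> {xs \<in> permutations_of_set A. {v \<in> A - {w}. prefers xs v w} = S}"
        using pref[of ys zs] s unfolding xs by auto
    next
      fix xs assume "xs \<in> {xs \<in> permutations_of_set A. {v \<in> A - {w}. prefers xs v w} = S}"
      then have xs: "distinct xs" "set xs = A" "{v \<in> A - {w}. prefers xs v w} = S"
        by (auto dest: permutations_of_setD)
      obtain ys zs where yz: "xs = ys @ w # zs"
        using split_list[of w xs] xs assms by auto
      have "set ys = S" using pref[of ys zs] xs yz by simp
      moreover have "set zs = Tl" using xs yz calculation unfolding Tl_def by auto
      ultimately show "xs \<in> f ` ?P"
        unfolding f_def using xs yz by (auto intro!: image_eqI[of _ _ "(ys, zs)"])
    qed
  qed
  then have "card {xs \<in> permutations_of_set A. {v \<in> A - {w}. prefers xs v w} = S} = card ?P"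
    by (rule bij_betw_same_card [symmetric])
  moreover have fin: "finite S" "finite Tl" using assms unfolding Tl_def by (auto intro: finite_subset)
  moreover have "card Tl = card A - 1 - card S"
    unfolding Tl_def using assms fin by (simp add: card_Diff_subset)
  ultimately show ?thesis by (simp add: card_cartesian_product)
qed

text \<open>
  The set of elements preceding \<open>w\<close> in a uniform permutation is distributed like a set that
  contains each other element independently with probability \<open>x\<close>, where \<open>x\<close> is uniform in \<open>[0, 1]\<close>.
\<close>

lemma nn_integral_prefers_mixture:
  fixes c d :: "nat \<Rightarrow> real"
  assumes "finite A" "w \<in> A" and nn: "\<And>v. c v \<ge> 0" "\<And>v. d v \<ge> 0"
  shows "(\<integral>\<^sup>+xs. ennreal (\<Prod>v\<in>A - {w}. if prefers xs v w then c v else d v)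
      \<partial>measure_pmf (pmf_of_set (permutations_of_set A))) =
    (\<integral>\<^sup>+x. ennreal (\<Prod>v\<in>A - {w}. x * c v + (1 - x) * d v) \<partial>restrict_space lborel {0..1})"
proof -
  define B where "B = A - {w}"
  have fB: "finite B" unfolding B_def using assms by simp
  define pd where "pd S = (\<Prod>v\<in>S. c v) * (\<Prod>v\<in>B - S. d v)" for S
  have pd0: "pd S \<ge> 0" for S unfolding pd_def using nn by (simp add: prod_nonneg)
  define N where "N = card A"
  have cB: "card B = N - 1" unfolding B_def N_def using assms by simp
  have N: "N > 0" unfolding N_def using assms card_gt_0_iff by blast
  define P where "P = permutations_of_set A"
  define pr where "pr xs = {v \<in> B. prefers xs v w}" for xs
  have P: "finite P" "P \<noteq> {}" "card P = fact N" unfolding P_def N_def using assms by auto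
  have "(\<integral>\<^sup>+xs. ennreal (\<Prod>v\<in>A - {w}. if prefers xs v w then c v else d v) \<partial>measure_pmf (pmf_of_set P))
    = (\<Sum>xs\<in>P. ennreal (\<Prod>v\<in>B. if prefers xs v w then c v else d v)) / ennreal (fact N)"
    using P by (simp add: nn_integral_pmf_of_set B_def ennreal_of_nat_eq_real_of_nat)
  also have "(\<Sum>xs\<in>P. ennreal (\<Prod>v\<in>B. if prefers xs v w then c v else d v)) = (\<Sum>xs\<in>P. ennreal (pd (pr xs)))"
  proof (intro sum.cong refl arg_cong[where f = ennreal])
    fix xs
    have "(\<Prod>v\<in>B. if prefers xs v w then c v else d v)
      = (\<Prod>v\<in>B \<inter> {v. prefers xs v w}. c v) * (\<Prod>v\<in>B \<inter> - {v. prefers xs v w}. d v)"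
      by (rule prod.If_cases[OF fB])
    also have "B \<inter> {v. prefers xs v w} = pr xs" unfolding pr_def by auto
    also have "B \<inter> - {v. prefers xs v w} = B - pr xs" unfolding pr_def by auto
    finally show "(\<Prod>v\<in>B. if prefers xs v w then c v else d v) = pd (pr xs)" unfolding pd_def .
  qed
  also have "\<dots> = (\<Sum>S\<in>Pow B. \<Sum>xs\<in>{xs \<in> P. pr xs = S}. ennreal (pd (pr xs)))"
    by (rule sum.group[symmetric]) (use P fB in \<open>auto simp: pr_def\<close>)
  also have "\<dots> = (\<Sum>S\<in>Pow B. ennreal (real (fact (card S) * fact (N - 1 - card S)) * pd S))"
  proof (intro sum.cong refl)
    fix S assume "S \<in> Pow B"
    then have "card {xs \<in> P. pr xs = S} = fact (card S) * fact (N - 1 - card S)"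
      unfolding P_def pr_def B_def N_def using card_permutations_split_at assms by auto
    moreover have "(\<Sum>xs\<in>{xs \<in> P. pr xs = S}. ennreal (pd (pr xs))) = of_nat (card {xs \<in> P. pr xs = S}) * ennreal (pd S)"
      by simp
    ultimately show "(\<Sum>xs\<in>{xs \<in> P. pr xs = S}. ennreal (pd (pr xs)))
        = ennreal (real (fact (card S) * fact (N - 1 - card S)) * pd S)"
      by (simp add: ennreal_of_nat_eq_real_of_nat ennreal_mult' pd0)
  qed
  also have "\<dots> / ennreal (fact N) = (\<Sum>S\<in>Pow B. ennreal (pd S * (fact (card S) * fact (N - 1 - card S) / fact N)))"
  proof -
    have "(\<Sum>S\<in>Pow B. ennreal (real (fact (card S) * fact (N - 1 - card S)) * pd S)) / ennreal (fact N)
      = (\<Sum>S\<in>Pow B. ennreal (real (fact (card S) * fact (N - 1 - card S)) * pd S) / ennreal (fact N))"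
      by (simp add: divide_ennreal_def sum_distrib_right)
    also have "\<dots> = (\<Sum>S\<in>Pow B. ennreal (pd S * (fact (card S) * fact (N - 1 - card S) / fact N)))"
      by (intro sum.cong refl) (subst divide_ennreal, auto simp: pd0 mult.commute)
    finally show ?thesis .
  qed
  \<comment> \<open>There are \<open>card S\<close> predecessors and \<open>N - 1 - card S\<close>
    successors of \<open>w\<close>. The exponents add up to \<open>N - 1\<close>, so the weight with
    denominator \<open>fact N\<close> is exactly a Beta integral.\<close>
  also have "\<dots> = (\<Sum>S\<in>Pow B. \<integral>\<^sup>+x. ennreal (pd S) * ennreal (x ^ card S * (1 - x) ^ (N - 1 - card S)) \<partial>restrict_space lborel {0..1::real})"
  proof (intro sum.cong refl)
    fix S assume "S \<in> Pow B"
    then have "card S \<le> N - 1" using cB card_mono[OF fB, of S] by auto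
    then have "card S + (N - 1 - card S) + 1 = N" using N by simp
    then show "ennreal (pd S * (fact (card S) * fact (N - 1 - card S) / fact N)) =
      (\<integral>\<^sup>+x. ennreal (pd S) * ennreal (x ^ card S * (1 - x) ^ (N - 1 - card S)) \<partial>restrict_space lborel {0..1::real})"
      by (subst nn_integral_cmult)
        (auto simp only: nn_integral_Beta_nat ennreal_mult' pd0 intro!: measurable_restrict_space1, measurable)
  qed
  also have "\<dots> = (\<integral>\<^sup>+x. (\<Sum>S\<in>Pow B. ennreal (pd S) * ennreal (x ^ card S * (1 - x) ^ (N - 1 - card S))) \<partial>restrict_space lborel {0..1::real})"
    by (rule nn_integral_sum[symmetric]) (auto intro!: measurable_restrict_space1)
  \<comment> \<open>The sum over subsets is the expansion of a product of two-term sums, read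
    backwards.\<close>
  also have "\<dots> = (\<integral>\<^sup>+x. ennreal (\<Prod>v\<in>A - {w}. x * c v + (1 - x) * d v) \<partial>restrict_space lborel {0..1::real})"
  proof (intro nn_integral_cong)
    fix x :: real assume "x \<in> space (restrict_space lborel {0..1})"
    then have x: "0 \<le> x" "x \<le> 1" by (auto simp: space_restrict_space)
    have "(\<Prod>v\<in>B. x * c v + (1 - x) * d v) = (\<Sum>S\<in>Pow B. (\<Prod>v\<in>S. x * c v) * (\<Prod>v\<in>B - S. (1 - x) * d v))"
      by (rule prod_add[OF fB])
    also have "\<dots> = (\<Sum>S\<in>Pow B. pd S * (x ^ card S * (1 - x) ^ (N - 1 - card S)))"
    proof (intro sum.cong refl)
      fix S assume "S \<in> Pow B"
      then have "card (B - S) = N - 1 - card S"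
        using cB fB by (auto simp: card_Diff_subset finite_subset)
      then show "(\<Prod>v\<in>S. x * c v) * (\<Prod>v\<in>B - S. (1 - x) * d v)
          = pd S * (x ^ card S * (1 - x) ^ (N - 1 - card S))"
        unfolding pd_def by (simp add: prod.distrib)
    qed
    finally show "(\<Sum>S\<in>Pow B. ennreal (pd S) * ennreal (x ^ card S * (1 - x) ^ (N - 1 - card S)))
        = ennreal (\<Prod>v\<in>A - {w}. x * c v + (1 - x) * d v)"
      using x pd0 by (simp add: B_def ennreal_mult [symmetric])
  qed
  finally show ?thesis unfolding P_def .
qed

section \<open>Integrals over the unit cube\<close>

interpretation unit_interval_product:
  product_sigma_finite "\<lambda>_::nat. restrict_space lborel {0..1::real}"
  unfolding product_sigma_finite_def
  by (auto intro!: sigma_finite_measure_restrict_space sigma_finite_lborel)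

lemma component_measurable_unit_interval:
  "i \<in> D \<Longrightarrow> (\<lambda>x. x i) \<in> borel_measurable (Pi\<^sub>M D (\<lambda>_. restrict_space lborel {0..1::real}))"
  by (rule measurable_compose[OF measurable_component_singleton]) (auto intro!: measurable_restrict_space1)

lemma nn_integral_unit_interval_FTC:
  fixes f F :: "real \<Rightarrow> real"
  assumes [measurable]: "f \<in> borel_measurable borel"
    and "\<And>x. 0 \<le> x \<Longrightarrow> x \<le> 1 \<Longrightarrow> (F has_real_derivative f x) (at x)"
    and "\<And>x. 0 \<le> x \<Longrightarrow> x \<le> 1 \<Longrightarrow> 0 \<le> f x"
  shows "(\<integral>\<^sup>+x. ennreal (f x) \<partial>restrict_space lborel {0..1}) = ennreal (F 1 - F 0)"
proof -
  have "(\<integral>\<^sup>+x. ennreal (f x) \<partial>restrict_space lborel {0..1}) = (\<integral>\<^sup>+x. ennreal (f x) * indicator {0..1} x \<partial>lborel)"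
    by (subst nn_integral_restrict_space) auto
  also have "\<dots> = ennreal (F 1 - F 0)"
    using assms(2,3) by (intro nn_integral_FTC_Icc assms(1)) auto
  finally show ?thesis .
qed

text \<open>The antiderivative is a negative multiple of the power with exponent
  \<open>-(k + 1)\<close>. Its value at 1 is nonpositive and is dropped, which leaves the boundary
  term at 0.\<close>

lemma nn_integral_inverse_affine_power_le:
  fixes p b :: real
  assumes "p > 0" "b > 0"
  shows "(\<integral>\<^sup>+y. ennreal (inverse ((p * y + b) ^ (k + 2))) \<partial>restrict_space lborel {0..1})
    \<le> ennreal (inverse (b ^ (k + 1)) * (1 / (p * real (k + 1))))"
proof -
  define c where "c = - 1 / (p * real (k + 1))"
  define F where "F y = c * inverse (p * y + b) ^ (k + 1)" for y
  have pos: "p * y + b > 0" if "0 \<le> y" for y using assms that by (simp add: add_nonneg_pos)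
  have "(\<integral>\<^sup>+y. ennreal (inverse ((p * y + b) ^ (k + 2))) \<partial>restrict_space lborel {0..1}) = ennreal (F 1 - F 0)"
  proof (rule nn_integral_unit_interval_FTC)
    fix y :: real assume "0 \<le> y" "y \<le> 1"
    have nz: "p * y + b \<noteq> 0" using pos[OF \<open>0 \<le> y\<close>] by simp
    show "0 \<le> inverse ((p * y + b) ^ (k + 2))" using pos[OF \<open>0 \<le> y\<close>] by simp
    show "(F has_real_derivative inverse ((p * y + b) ^ (k + 2))) (at y)"
    proof -
      have "((\<lambda>y. p * y + b) has_real_derivative p) (at y)"
        by (auto intro!: derivative_eq_intros)
      from DERIV_cmult[OF DERIV_power[OF DERIV_inverse'[OF this nz], of "k + 1"], of c]
      have "(F has_real_derivative c * (real (k + 1) * (- (inverse (p * y + b) * p * inverse (p * y + b)) *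
        inverse (p * y + b) ^ k))) (at y)"
        unfolding F_def by simp
      also have "c * (real (k + 1) * (- (inverse (p * y + b) * p * inverse (p * y + b)) * inverse (p * y + b) ^ k))
        = - (c * (p * real (k + 1))) * inverse (p * y + b) ^ (k + 2)"
        by (simp add: mult_ac)
      also have "c * (p * real (k + 1)) = - 1" unfolding c_def using assms by simp
      finally show ?thesis by (simp add: power_inverse)
    qed
  qed auto
  also have "F 1 - F 0 \<le> inverse (b ^ (k + 1)) * (1 / (p * real (k + 1)))"
  proof -
    have "F 0 = - (inverse (b ^ (k + 1)) * (1 / (p * real (k + 1))))" unfolding F_def c_def by (simp add: power_inverse)
    moreover have "F 1 \<le> 0" unfolding F_def c_def using assms pos[of 1]
      by (intro mult_nonpos_nonneg) (auto simp: divide_nonpos_pos)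
    ultimately show ?thesis by linarith
  qed
  finally show ?thesis by (simp add: ennreal_leI)
qed

text \<open>
  Replaces the density of a sum of uniform variables: a pointwise bound by this power of the sum
  costs only a factor \<open>1 / a\<close> against the volume \<open>1 / k!\<close> of the simplex.
\<close>

lemma nn_integral_inverse_sum_power_le:
  fixes p a :: real and D :: "nat set"
  assumes "p > 0" "a > 0" "finite D"
  shows "(\<integral>\<^sup>+x. ennreal (inverse ((p * (\<Sum>i\<in>D. x i) + a) ^ (card D + 1)))
      \<partial>Pi\<^sub>M D (\<lambda>_. restrict_space lborel {0..1}))
    \<le> ennreal (1 / (p ^ card D * fact (card D) * a))"
  using \<open>finite D\<close>
proof (induction D)
  case empty
  show ?case using \<open>a > 0\<close> by (simp add: PiM_empty nn_integral_count_space_finite inverse_eq_divide)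
next
  case (insert i D)
  let ?U = "\<lambda>_::nat. restrict_space lborel {0..1::real}"
  note component_measurable_unit_interval [measurable]
  have "(\<integral>\<^sup>+x. ennreal (inverse ((p * (\<Sum>i\<in>insert i D. x i) + a) ^ (card (insert i D) + 1))) \<partial>Pi\<^sub>M (insert i D) ?U)
    = (\<integral>\<^sup>+x. \<integral>\<^sup>+y. ennreal (inverse ((p * (\<Sum>j\<in>insert i D. (x(i := y)) j) + a) ^ (card (insert i D) + 1))) \<partial>restrict_space lborel {0..1} \<partial>Pi\<^sub>M D ?U)"
    by (rule unit_interval_product.product_nn_integral_insert) (use insert in measurable)
  \<comment> \<open>Integrating out the new coordinate lowers the exponent by one and yields
    \<open>1 / (p * (card D + 1))\<close>. These factors accumulate to the power of \<open>p\<close>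
    and the factorial.\<close>
  also have "\<dots> \<le> (\<integral>\<^sup>+x. ennreal (inverse ((p * (\<Sum>i\<in>D. x i) + a) ^ (card D + 1))) * ennreal (1 / (p * real (card D + 1))) \<partial>Pi\<^sub>M D ?U)"
  proof (rule nn_integral_mono)
    fix x assume "x \<in> space (Pi\<^sub>M D ?U)"
    then have "x j \<ge> 0" if "j \<in> D" for j
      using that by (auto simp: space_PiM space_restrict_space PiE_def Pi_def)
    then have "p * (\<Sum>i\<in>D. x i) + a > 0" using assms by (intro add_nonneg_pos mult_nonneg_nonneg sum_nonneg) auto
    from nn_integral_inverse_affine_power_le[OF \<open>p > 0\<close> this, of "card D"]
    have "(\<integral>\<^sup>+y. ennreal (inverse ((p * y + (p * (\<Sum>i\<in>D. x i) + a)) ^ (card D + 2))) \<partial>restrict_space lborel {0..1})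
      \<le> ennreal (inverse ((p * (\<Sum>i\<in>D. x i) + a) ^ (card D + 1))) * ennreal (1 / (p * real (card D + 1)))"
      using \<open>p * (\<Sum>i\<in>D. x i) + a > 0\<close> \<open>p > 0\<close>
      by (subst ennreal_mult [symmetric]) (auto simp del: power_Suc)
    moreover have "(\<Sum>j\<in>insert i D. (x(i := y)) j) = y + (\<Sum>j\<in>D. x j)" for y
      using insert by (simp, intro sum.cong) auto
    ultimately show "(\<integral>\<^sup>+y. ennreal (inverse ((p * (\<Sum>j\<in>insert i D. (x(i := y)) j) + a) ^ (card (insert i D) + 1))) \<partial>restrict_space lborel {0..1})
      \<le> ennreal (inverse ((p * (\<Sum>i\<in>D. x i) + a) ^ (card D + 1))) * ennreal (1 / (p * real (card D + 1)))"
      using insert by (simp add: algebra_simps)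
  qed
  also have "\<dots> = (\<integral>\<^sup>+x. ennreal (inverse ((p * (\<Sum>i\<in>D. x i) + a) ^ (card D + 1))) \<partial>Pi\<^sub>M D ?U) * ennreal (1 / (p * real (card D + 1)))"
    by (rule nn_integral_multc) measurable
  also have "\<dots> \<le> ennreal (1 / (p ^ card D * fact (card D) * a)) * ennreal (1 / (p * real (card D + 1)))"
    by (intro mult_right_mono insert.IH) auto
  also have "\<dots> = ennreal (1 / (p ^ card (insert i D) * fact (card (insert i D)) * a))"
    using insert assms by (subst ennreal_mult [symmetric]) (auto simp: mult_ac)
  finally show ?case .
qed

text \<open>The rate \<open>\<tau>\<close> will be \<open>p * (s x + l)\<close>, which may vanish.
  Shifting it by \<open>a > 0\<close> keeps the denominator positive and costs at most
  \<open>exp a\<close>, because \<open>z * y\<close> is at most 1. The leading \<open>z\<close>,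
  contributed by the matched pair, cancels against the \<open>z\<close> in the rate.\<close>

lemma nn_integral_exp_unit_interval_le:
  fixes z \<tau> a :: real
  assumes "0 < z" "z \<le> 1" "0 \<le> \<tau>" "0 < a"
  shows "(\<integral>\<^sup>+y. ennreal (z * exp (- (z * \<tau> * y))) \<partial>restrict_space lborel {0..1})
    \<le> ennreal (exp a * ((1 - exp (- (\<tau> + a))) / (\<tau> + a)))"
proof -
  define c where "c = - (exp a / (\<tau> + a))"
  define F where "F y = c * exp (- (z * (\<tau> + a) * y))" for y
  have pos: "\<tau> + a > 0" using assms by simp
  have "(\<integral>\<^sup>+y. ennreal (z * exp (- (z * \<tau> * y))) \<partial>restrict_space lborel {0..1})
    \<le> (\<integral>\<^sup>+y. ennreal (exp a * (z * exp (- (z * (\<tau> + a) * y)))) \<partial>restrict_space lborel {0..1})"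
  proof (intro nn_integral_mono ennreal_leI)
    fix y :: real assume "y \<in> space (restrict_space lborel {0..1})"
    then have "0 \<le> y" "y \<le> 1" by (auto simp: space_restrict_space)
    then have "z * y \<le> 1" using assms by (intro mult_le_one) auto
    then have "a * (z * y) \<le> a" using assms by simp
    then have "exp (- (z * \<tau> * y)) \<le> exp (a + - (z * (\<tau> + a) * y))" by (simp add: algebra_simps)
    then have "exp (- (z * \<tau> * y)) \<le> exp a * exp (- (z * (\<tau> + a) * y))"
      by (simp only: exp_add)
    from mult_left_mono[OF this, of z] show "z * exp (- (z * \<tau> * y)) \<le> exp a * (z * exp (- (z * (\<tau> + a) * y)))"
      using assms by (simp add: mult.left_commute)
  qed
  also have "\<dots> = ennreal (F 1 - F 0)"
  proof (rule nn_integral_unit_interval_FTC)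
    fix y :: real
    show "(F has_real_derivative exp a * (z * exp (- (z * (\<tau> + a) * y)))) (at y)"
    proof -
      have "(F has_real_derivative c * (exp (- (z * (\<tau> + a) * y)) * (- (z * (\<tau> + a))))) (at y)"
        unfolding F_def by (auto intro!: derivative_eq_intros)
      also have "c * (exp (- (z * (\<tau> + a) * y)) * (- (z * (\<tau> + a))))
        = - (c * (\<tau> + a)) * (z * exp (- (z * (\<tau> + a) * y)))" by simp
      also have "c * (\<tau> + a) = - exp a" unfolding c_def using pos by simp
      finally show ?thesis by simp
    qed
  qed (use assms in auto)
  also have "F 1 - F 0 = exp a * ((1 - exp (- (z * (\<tau> + a)))) / (\<tau> + a))"
    unfolding F_def c_def by (simp add: diff_divide_distrib right_diff_distrib)
  also have "\<dots> \<le> exp a * ((1 - exp (- (\<tau> + a))) / (\<tau> + a))"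
  proof -
    have "z * (\<tau> + a) \<le> \<tau> + a" using mult_right_mono[of z 1 "\<tau> + a"] assms pos by simp
    then have "1 - exp (- (z * (\<tau> + a))) \<le> 1 - exp (- (\<tau> + a))" by simp
    then show ?thesis using pos by (intro mult_left_mono divide_right_mono) auto
  qed
  finally show ?thesis by (simp add: ennreal_leI)
qed

section \<open>The probability that a given matching is stable and cheap\<close>

text \<open>With finite support the outer integral is a finite sum, so linearity suffices and
  measurability is asked of each slice only.\<close>

lemma nn_integral_pmf_swap:
  fixes f :: "'b \<Rightarrow> 'c \<Rightarrow> ennreal"
  assumes "finite (set_pmf P)" "\<And>a. f a \<in> borel_measurable N"
  shows "(\<integral>\<^sup>+a. \<integral>\<^sup>+x. f a x \<partial>N \<partial>measure_pmf P) = (\<integral>\<^sup>+x. \<integral>\<^sup>+a. f a x \<partial>measure_pmf P \<partial>N)"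
  using assms by (simp add: nn_integral_measure_pmf_finite nn_integral_sum nn_integral_multc)

lemma finite_set_random_prefs: "finite (set_pmf (random_prefs n))"
  unfolding random_prefs_def by (simp add: set_Pi_pmf finite_PiE_dflt)

text \<open>The candidate is the graph of the injection \<open>h\<close> on \<open>D\<close>. The
  number \<open>z\<close> is the base of the weight on the total rank; it is at most 1 because low
  totals are to be emphasised.\<close>

locale candidate_matching =
  fixes n :: nat and D :: "nat set" and h :: "nat \<Rightarrow> nat" and p z :: real
  assumes D: "D \<subseteq> {..<n}" and h: "h ` D \<subseteq> {..<n}" and inj: "inj_on h D"
    and p: "0 < p" "p < 1" and z: "0 < z" "z \<le> 1"
begin

definition R where "R = h ` D"
definition g where "g = inv_into D h"
definition M where "M = (\<lambda>m. (m, h m)) ` D"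
text \<open>Unmatched men do not contribute to the total rank, hence their weight is 1.\<close>

definition \<zeta> where "\<zeta> m = (if m \<in> D then z else 1)"
definition would_accept_m where "would_accept_m xs m w \<longleftrightarrow> (m \<in> D \<longrightarrow> prefers xs w (h m))"
definition would_accept_w where "would_accept_w ys w m \<longleftrightarrow> (w \<in> R \<longrightarrow> prefers ys m (g w))"

text \<open>A factor for each pair, chosen so that the product over all pairs carries both the rank
  weight and the stability constraint. A matched pair must be admissible and yields \<open>z\<close>
  for the 1 in the rank. An admissible pair that the man would accept must be refused by the woman,
  and then yields \<open>z\<close> if it counts towards his wife's rank. As a product over pairs, it
  can be averaged over admissibility pair by pair.\<close>

definition wt :: "prefs \<Rightarrow> prefs \<Rightarrow> nat \<times> nat \<Rightarrow> bool \<Rightarrow> real" where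
  "wt mp wp e b = (case e of (m, w) \<Rightarrow>
     if m \<in> D \<and> w = h m then (if b then z else 0)
     else if b \<and> would_accept_m (mp m) m w then (if would_accept_w (wp w) w m then 0 else \<zeta> m)
     else 1)"

lemma fin [simp]: "finite D" "finite R"
  unfolding R_def using D finite_subset by auto

lemma card_R: "card R = card D"
  unfolding R_def by (rule card_image[OF inj])

lemma R: "R \<subseteq> {..<n}" unfolding R_def by (rule h)

lemma card_D_le: "card D \<le> n" using card_mono[OF _ D] by simp

lemma g: "w \<in> R \<Longrightarrow> g w \<in> D" "w \<in> R \<Longrightarrow> h (g w) = w" "m \<in> D \<Longrightarrow> g (h m) = m"
  unfolding R_def g_def using inj by (auto simp: inv_into_into f_inv_into_f)

lemma \<zeta>: "0 < \<zeta> m" "\<zeta> m \<le> 1"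
  unfolding \<zeta>_def using z by auto

lemma wt_nonneg: "0 \<le> wt mp wp e b"
  unfolding wt_def using z \<zeta> by (auto split: prod.split simp: less_imp_le)

text \<open>Stability excludes mutual acceptance of an admissible pair outside \<open>M\<close>.
  Hence the row of a matched man has one factor \<open>z\<close> for his wife and one for each
  admissible woman he prefers to her, while rows of unmatched men consist of ones.\<close>

lemma prod_wt_stable:
  assumes st: "stable_matching n (mp, wp, adm) M"
    and mp: "\<And>m. m < n \<Longrightarrow> distinct (mp m)"
  shows "(\<Prod>e\<in>{..<n} \<times> {..<n}. wt mp wp e (adm e)) = z ^ total_wife_rank n (mp, wp, adm) M"
proof -
  let ?I = "(mp, wp, adm)"
  have M_iff: "(m, w) \<in> M \<longleftrightarrow> m \<in> D \<and> w = h m" for m w unfolding M_def by auto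
  have Dom: "Domain M = D" "Range M = R" unfolding M_def R_def by force+
  have adm: "adm (m, h m)" if "m \<in> D" for m
    using st that M_iff unfolding stable_matching_def is_matching_def by auto
  have nb: "\<not> blocking_pair n ?I M m w" for m w
    using st unfolding stable_matching_def by auto
  have not_both: "\<not> would_accept_w (wp w) w m"
    if "m < n" "w < n" "\<not> (m \<in> D \<and> w = h m)" "adm (m, w)" "would_accept_m (mp m) m w" for m w
  proof
    assume "would_accept_w (wp w) w m"
    moreover have "(g w, w) \<in> M" if "w \<in> R" using that g M_iff by auto
    ultimately have "blocking_pair n ?I M m w"
      using that unfolding would_accept_w_def would_accept_m_def
      by (auto simp: M_iff Dom)
    with nb show False by blast
  qed
  have row: "(\<Prod>w<n. wt mp wp (m, w) (adm (m, w))) = (if m \<in> D then z ^ wife_rank n ?I m (h m) else 1)"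
    if m: "m < n" for m
  proof (cases "m \<in> D")
    case False
    then have "wt mp wp (m, w) (adm (m, w)) = 1" if "w < n" for w
      using not_both[OF m that] unfolding wt_def \<zeta>_def by auto
    then show ?thesis using False by simp
  next
    case True
    have hm: "h m < n" using True h by auto
    define S where "S = {w'. (m, w') \<in> admissible_pairs n ?I \<and> prefers (mp m) w' (h m)}"
    have irr: "\<not> prefers (mp m) (h m) (h m)"
      using prefers_irrefl[OF mp[OF m]] .
    have "(\<Prod>w<n. wt mp wp (m, w) (adm (m, w)))
      = wt mp wp (m, h m) (adm (m, h m)) * (\<Prod>w\<in>{..<n} - {h m}. wt mp wp (m, w) (adm (m, w)))"
      using hm by (intro prod.remove) auto
    also have "wt mp wp (m, h m) (adm (m, h m)) = z"
      unfolding wt_def using True adm by simp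
    also have "(\<Prod>w\<in>{..<n} - {h m}. wt mp wp (m, w) (adm (m, w)))
      = (\<Prod>w\<in>{..<n} - {h m}. if w \<in> S then z else 1)"
    proof (intro prod.cong refl)
      fix w assume w: "w \<in> {..<n} - {h m}"
      then have "w \<in> S \<longleftrightarrow> adm (m, w) \<and> would_accept_m (mp m) m w"
        unfolding S_def would_accept_m_def using m True by auto
      then show "wt mp wp (m, w) (adm (m, w)) = (if w \<in> S then z else 1)"
        using not_both[OF m, of w] w True unfolding wt_def \<zeta>_def by auto
    qed
    also have "\<dots> = z ^ card (({..<n} - {h m}) \<inter> S)"
      by (simp add: prod.If_cases Int_def)
    \<comment> \<open>Irreflexivity, and with it distinctness of the list, ensures that the wife is
      not counted a second time among the preferred women.\<close>
    also have "({..<n} - {h m}) \<inter> S = S" unfolding S_def using irr by auto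
    finally show ?thesis using True unfolding S_def by simp
  qed
  have "(\<Prod>e\<in>{..<n} \<times> {..<n}. wt mp wp e (adm e)) = (\<Prod>m<n. \<Prod>w<n. wt mp wp (m, w) (adm (m, w)))"
    by (simp add: prod.cartesian_product case_prod_beta)
  also have "\<dots> = (\<Prod>m<n. if m \<in> D then z ^ wife_rank n ?I m (h m) else 1)"
    using row by (intro prod.cong) auto
  also have "\<dots> = (\<Prod>m\<in>D. z ^ wife_rank n ?I m (h m))"
    using D by (simp add: prod.If_cases Int_absorb1)
  also have "\<dots> = z ^ (\<Sum>m\<in>D. wife_rank n ?I m (h m))"
    by (simp add: power_sum)
  also have "(\<Sum>m\<in>D. wife_rank n ?I m (h m)) = total_wife_rank n ?I M"
    unfolding total_wife_rank_def M_def by (subst sum.reindex) (auto simp: inj_on_def)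
  finally show ?thesis .
qed

text \<open>
  Below \<open>x m\<close> is the uniform variable attached to the preference list of a matched man \<open>m\<close>;
  unmatched men behave as if it were \<open>1\<close>.
\<close>

definition xh :: "(nat \<Rightarrow> real) \<Rightarrow> nat \<Rightarrow> real" where "xh x m = (if m \<in> D then x m else 1)"

text \<open>The mean of \<open>wt\<close> over admissibility for a non-matching pair that the man
  would accept. The flag \<open>b\<close> says whether the woman would accept too, in which case the
  pair has to be inadmissible.\<close>

definition c :: "nat \<Rightarrow> bool \<Rightarrow> real" where "c m b = (if b then 1 - p else 1 - p + p * \<zeta> m)"

text \<open>The row of man \<open>m\<close> once his list has been replaced by the uniform variable
  \<open>x\<close>. The form \<open>x * c + (1 - x) * 1\<close> is that of the mixture lemma with
  second coefficient 1.\<close>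

definition G :: "prefs \<Rightarrow> nat \<Rightarrow> real \<Rightarrow> real" where
  "G wp m x = (\<Prod>w<n. if m \<in> D \<and> w = h m then z * p
     else x * c m (would_accept_w (wp w) w m) + (1 - x) * 1)"

lemma c_nonneg: "0 \<le> c m b"
  unfolding c_def using p \<zeta>[of m] by (auto simp: add_nonneg_nonneg less_imp_le)

section \<open>Averaging over admissibility and over the men's lists\<close>

lemma nn_integral_admissibility:
  "(\<integral>\<^sup>+adm. ennreal (\<Prod>e\<in>{..<n} \<times> {..<n}. wt mp wp e (adm e)) \<partial>measure_pmf (random_admissibility n p))
   = ennreal (\<Prod>m<n. \<Prod>w<n. if m \<in> D \<and> w = h m then z * p
        else if would_accept_m (mp m) m w then c m (would_accept_w (wp w) w m) else 1)"
proof -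
  have "(\<integral>\<^sup>+adm. ennreal (\<Prod>e\<in>{..<n} \<times> {..<n}. wt mp wp e (adm e)) \<partial>measure_pmf (random_admissibility n p))
    = (\<integral>\<^sup>+adm. (\<Prod>e\<in>{..<n} \<times> {..<n}. ennreal (wt mp wp e (adm e))) \<partial>measure_pmf (random_admissibility n p))"
    by (simp add: prod_ennreal wt_nonneg)
  also have "\<dots> = (\<Prod>e\<in>{..<n} \<times> {..<n}. \<integral>\<^sup>+b. ennreal (wt mp wp e b) \<partial>measure_pmf (bernoulli_pmf p))"
    unfolding random_admissibility_def by (rule nn_integral_prod_Pi_pmf) simp
  also have "\<dots> = (\<Prod>e\<in>{..<n} \<times> {..<n}. ennreal (case e of (m, w) \<Rightarrow> if m \<in> D \<and> w = h m then z * p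
        else if would_accept_m (mp m) m w then c m (would_accept_w (wp w) w m) else 1))"
  proof (intro prod.cong refl)
    fix e
    have "(\<integral>\<^sup>+b. ennreal (wt mp wp e b) \<partial>measure_pmf (bernoulli_pmf p))
      = ennreal (wt mp wp e True * p + wt mp wp e False * (1 - p))"
      using p wt_nonneg by (simp add: ennreal_mult' ennreal_plus)
    also have "wt mp wp e True * p + wt mp wp e False * (1 - p) = (case e of (m, w) \<Rightarrow> if m \<in> D \<and> w = h m then z * p
        else if would_accept_m (mp m) m w then c m (would_accept_w (wp w) w m) else 1)"
      unfolding wt_def c_def by (auto split: prod.split simp: algebra_simps)
    finally show "(\<integral>\<^sup>+b. ennreal (wt mp wp e b) \<partial>measure_pmf (bernoulli_pmf p)) = ennreal (case e of (m, w) \<Rightarrow> if m \<in> D \<and> w = h m then z * p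
        else if would_accept_m (mp m) m w then c m (would_accept_w (wp w) w m) else 1)" .
  qed
  also have "\<dots> = ennreal (\<Prod>e\<in>{..<n} \<times> {..<n}. (case e of (m, w) \<Rightarrow> if m \<in> D \<and> w = h m then z * p
        else if would_accept_m (mp m) m w then c m (would_accept_w (wp w) w m) else 1))"
    using z p c_nonneg by (intro prod_ennreal) auto
  finally show ?thesis by (simp add: prod.cartesian_product)
qed

lemma G_nonneg: "0 \<le> x \<Longrightarrow> x \<le> 1 \<Longrightarrow> 0 \<le> G wp m x"
  unfolding G_def using z p c_nonneg by (intro prod_nonneg) (auto intro!: add_nonneg_nonneg)

lemma G_measurable: "G wp m \<in> borel_measurable borel"
  unfolding G_def by measurable

lemma unit_space: "x \<in> space (Pi\<^sub>M D (\<lambda>_. restrict_space lborel {0..1::real})) \<Longrightarrow> 0 \<le> xh x m \<and> xh x m \<le> 1"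
  unfolding xh_def by (auto simp: space_PiM space_restrict_space PiE_def Pi_def)

text \<open>The lists are independent, so the expectation splits into rows. A matched man's row is
  given by the mixture lemma applied at his wife; an unmatched man's row does not depend on his list
  and equals \<open>G\<close> at 1. The one-dimensional integrals recombine into one over the cube
  indexed by \<open>D\<close>.\<close>

lemma nn_integral_men_prefs:
  "(\<integral>\<^sup>+mp. ennreal (\<Prod>m<n. \<Prod>w<n. if m \<in> D \<and> w = h m then z * p
        else if would_accept_m (mp m) m w then c m (would_accept_w (wp w) w m) else 1)
      \<partial>measure_pmf (random_prefs n))
   = (\<integral>\<^sup>+x. ennreal (\<Prod>m<n. G wp m (xh x m)) \<partial>Pi\<^sub>M D (\<lambda>_. restrict_space lborel {0..1}))"
proof -
  let ?U = "restrict_space lborel {0..1::real}"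
  have mG': "(\<lambda>x. ennreal (G wp m x)) \<in> borel_measurable ?U" for m
    by (rule measurable_restrict_space1) (simp add: measurable_compose[OF G_measurable measurable_ennreal])
  have mG: "(\<lambda>x. ennreal (G wp m (x m))) \<in> borel_measurable (Pi\<^sub>M D (\<lambda>_. ?U))" if "m \<in> D" for m
    by (rule measurable_compose[OF component_measurable_unit_interval[OF that]
          measurable_compose[OF G_measurable measurable_ennreal]])
  define f where "f m xs = (\<Prod>w<n. if m \<in> D \<and> w = h m then z * p
        else if would_accept_m xs m w then c m (would_accept_w (wp w) w m) else 1)" for m xs
  have f0: "f m xs \<ge> 0" for m xs
    unfolding f_def using z p c_nonneg by (intro prod_nonneg) auto
  have "(\<integral>\<^sup>+mp. ennreal (\<Prod>m<n. f m (mp m)) \<partial>measure_pmf (random_prefs n))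
    = (\<integral>\<^sup>+mp. (\<Prod>m<n. ennreal (f m (mp m))) \<partial>measure_pmf (random_prefs n))"
    by (simp add: prod_ennreal f0)
  also have "\<dots> = (\<Prod>m<n. \<integral>\<^sup>+xs. ennreal (f m xs) \<partial>measure_pmf (pmf_of_set (permutations_of_set {..<n})))"
    unfolding random_prefs_def by (rule nn_integral_prod_Pi_pmf) simp
  also have "\<dots> = (\<Prod>m<n. if m \<in> D then \<integral>\<^sup>+x. ennreal (G wp m x) \<partial>?U else ennreal (G wp m 1))"
  proof (intro prod.cong refl)
    fix m assume m: "m \<in> {..<n}"
    show "(\<integral>\<^sup>+xs. ennreal (f m xs) \<partial>measure_pmf (pmf_of_set (permutations_of_set {..<n})))
      = (if m \<in> D then \<integral>\<^sup>+x. ennreal (G wp m x) \<partial>?U else ennreal (G wp m 1))"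
    proof (cases "m \<in> D")
      case False
      then have "f m xs = G wp m 1" for xs
        unfolding f_def G_def would_accept_m_def by simp
      then show ?thesis using False by (simp add: measure_pmf.emeasure_space_1)
    next
      case True
      then have hm: "h m \<in> {..<n}" using h by auto
      have meas: "(\<lambda>x. ennreal (\<Prod>w\<in>{..<n} - {h m}. x * c' w + (1 - x) * 1)) \<in> borel_measurable ?U"
        for c'
      proof (rule measurable_restrict_space1)
        show "(\<lambda>x. ennreal (\<Prod>w\<in>{..<n} - {h m}. x * c' w + (1 - x) * 1)) \<in> borel_measurable lborel"
          by (intro measurable_compose[OF _ measurable_ennreal] borel_measurable_prod) simp
      qed
      define c' where "c' w = c m (would_accept_w (wp w) w m)" for w
      have c': "c' w \<ge> 0" for w unfolding c'_def by (rule c_nonneg)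
      have "f m xs = z * p * (\<Prod>w\<in>{..<n} - {h m}. if prefers xs w (h m) then c' w else 1)" for xs
      proof -
        have "f m xs = z * p * (\<Prod>w\<in>{..<n} - {h m}. if m \<in> D \<and> w = h m then z * p
          else if would_accept_m xs m w then c m (would_accept_w (wp w) w m) else 1)"
          unfolding f_def using hm True by (subst prod.remove[of _ "h m"]) auto
        also have "\<dots> = z * p * (\<Prod>w\<in>{..<n} - {h m}. if prefers xs w (h m) then c' w else 1)"
          using True unfolding would_accept_m_def c'_def
          by (intro arg_cong[where f = "\<lambda>t. z * p * t"] prod.cong) auto
        finally show ?thesis .
      qed
      then have "(\<integral>\<^sup>+xs. ennreal (f m xs) \<partial>measure_pmf (pmf_of_set (permutations_of_set {..<n})))
        = ennreal (z * p) * (\<integral>\<^sup>+xs. ennreal (\<Prod>w\<in>{..<n} - {h m}. if prefers xs w (h m) then c' w else 1)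
          \<partial>measure_pmf (pmf_of_set (permutations_of_set {..<n})))"
        using z p by (simp add: ennreal_mult' nn_integral_cmult)
      also have "\<dots> = ennreal (z * p) * (\<integral>\<^sup>+x. ennreal (\<Prod>w\<in>{..<n} - {h m}. x * c' w + (1 - x) * 1) \<partial>?U)"
        using hm c' by (subst nn_integral_prefers_mixture) auto
      also have "\<dots> = (\<integral>\<^sup>+x. ennreal (z * p) * ennreal (\<Prod>w\<in>{..<n} - {h m}. x * c' w + (1 - x) * 1) \<partial>?U)"
        by (rule nn_integral_cmult[OF meas, symmetric])
      also have "\<dots> = (\<integral>\<^sup>+x. ennreal (G wp m x) \<partial>?U)"
      proof (intro nn_integral_cong)
        fix x :: real
        have "G wp m x = z * p * (\<Prod>w\<in>{..<n} - {h m}. if m \<in> D \<and> w = h m then z * p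
          else x * c m (would_accept_w (wp w) w m) + (1 - x) * 1)"
          unfolding G_def using hm True by (subst prod.remove[of _ "h m"]) auto
        also have "\<dots> = z * p * (\<Prod>w\<in>{..<n} - {h m}. x * c' w + (1 - x) * 1)"
          unfolding c'_def by (intro arg_cong[where f = "\<lambda>t. z * p * t"] prod.cong) auto
        finally show "ennreal (z * p) * ennreal (\<Prod>w\<in>{..<n} - {h m}. x * c' w + (1 - x) * 1) = ennreal (G wp m x)"
          using z p by (simp add: ennreal_mult')
      qed
      finally show ?thesis using True by simp
    qed
  qed
  also have "\<dots> = (\<Prod>m\<in>D. \<integral>\<^sup>+x. ennreal (G wp m x) \<partial>?U) * (\<Prod>m\<in>{..<n} - D. ennreal (G wp m 1))"
    using D by (simp add: prod.If_cases Int_absorb1 Diff_eq)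
  also have "(\<Prod>m\<in>D. \<integral>\<^sup>+x. ennreal (G wp m x) \<partial>?U) = (\<integral>\<^sup>+x. (\<Prod>m\<in>D. ennreal (G wp m (x m))) \<partial>Pi\<^sub>M D (\<lambda>_. ?U))"
    using mG' by (intro unit_interval_product.product_nn_integral_prod[of D "\<lambda>m x. ennreal (G wp m x)", symmetric]) auto
  also have "\<dots> * (\<Prod>m\<in>{..<n} - D. ennreal (G wp m 1)) =
      (\<integral>\<^sup>+x. (\<Prod>m\<in>D. ennreal (G wp m (x m))) * (\<Prod>m\<in>{..<n} - D. ennreal (G wp m 1)) \<partial>Pi\<^sub>M D (\<lambda>_. ?U))"
    by (intro nn_integral_multc[symmetric] borel_measurable_prod_ennreal mG)
  also have "\<dots> = (\<integral>\<^sup>+x. ennreal (\<Prod>m<n. G wp m (xh x m)) \<partial>Pi\<^sub>M D (\<lambda>_. ?U))"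
  proof (intro nn_integral_cong)
    fix x assume x: "x \<in> space (Pi\<^sub>M D (\<lambda>_. ?U))"
    have "(\<Prod>m\<in>D. ennreal (G wp m (x m))) * (\<Prod>m\<in>{..<n} - D. ennreal (G wp m 1))
      = (\<Prod>m\<in>D. ennreal (G wp m (xh x m))) * (\<Prod>m\<in>{..<n} - D. ennreal (G wp m (xh x m)))"
      by (intro arg_cong2[where f = "(*)"] prod.cong) (auto simp: xh_def)
    also have "\<dots> = (\<Prod>m<n. ennreal (G wp m (xh x m)))"
      using prod.subset_diff[OF D, of "\<lambda>m. ennreal (G wp m (xh x m))"] by (simp add: mult.commute)
    also have "\<dots> = ennreal (\<Prod>m<n. G wp m (xh x m))"
      using unit_space[OF x] by (intro prod_ennreal G_nonneg) auto
    finally show "(\<Prod>m\<in>D. ennreal (G wp m (x m))) * (\<Prod>m\<in>{..<n} - D. ennreal (G wp m 1)) = ennreal (\<Prod>m<n. G wp m (xh x m))" .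
  qed
  finally show ?thesis unfolding f_def .
qed


section \<open>Averaging over the women's lists for fixed variables of the men\<close>

lemma nn_integral_women_prefs:
  assumes x: "x \<in> space (Pi\<^sub>M D (\<lambda>_. restrict_space lborel {0..1::real}))"
  shows "(\<integral>\<^sup>+wp. ennreal (\<Prod>m<n. G wp m (xh x m)) \<partial>measure_pmf (random_prefs n))
   = (\<Prod>w<n. \<integral>\<^sup>+ys. ennreal (\<Prod>m<n. if m \<in> D \<and> w = h m then z * p
     else xh x m * c m (would_accept_w ys w m) + (1 - xh x m) * 1)
       \<partial>measure_pmf (pmf_of_set (permutations_of_set {..<n})))"
proof -
  define k where "k w ys = (\<Prod>m<n. if m \<in> D \<and> w = h m then z * p
     else xh x m * c m (would_accept_w ys w m) + (1 - xh x m) * 1)" for w ys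
  have k: "k w ys \<ge> 0" for w ys
    unfolding k_def using unit_space[OF x] z p c_nonneg
    by (intro prod_nonneg) (auto intro!: add_nonneg_nonneg)
  have "(\<integral>\<^sup>+wp. ennreal (\<Prod>m<n. G wp m (xh x m)) \<partial>measure_pmf (random_prefs n))
    = (\<integral>\<^sup>+wp. (\<Prod>w<n. ennreal (k w (wp w))) \<partial>measure_pmf (random_prefs n))"
  proof (intro nn_integral_cong)
    fix wp
    \<comment> \<open>With \<open>x\<close> fixed, each woman's list enters only her own column, so
      exchanging the products makes independence applicable.\<close>
    have "(\<Prod>m<n. G wp m (xh x m)) = (\<Prod>w<n. k w (wp w))"
      unfolding G_def k_def by (rule prod.swap)
    then show "ennreal (\<Prod>m<n. G wp m (xh x m)) = (\<Prod>w<n. ennreal (k w (wp w)))"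
      by (simp add: prod_ennreal k)
  qed
  also have "\<dots> = (\<Prod>w<n. \<integral>\<^sup>+ys. ennreal (k w ys) \<partial>measure_pmf (pmf_of_set (permutations_of_set {..<n})))"
    unfolding random_prefs_def by (rule nn_integral_prod_Pi_pmf) simp
  finally show ?thesis unfolding k_def .
qed

definition s where "s x = (\<Sum>m\<in>D. x m)"
definition l where "l = real (n - card D)"

lemma l: "l = real n - real (card D)" "0 \<le> l"
  unfolding l_def using card_D_le by auto

lemma s_nonneg: "x \<in> space (Pi\<^sub>M D (\<lambda>_. restrict_space lborel {0..1::real})) \<Longrightarrow> 0 \<le> s x"
  unfolding s_def by (intro sum_nonneg) (auto simp: space_PiM space_restrict_space PiE_def Pi_def)

text \<open>Evaluates the exponent arising in \<open>prod_factor_le\<close>: it depends on the men's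
  variables only through their sum. Each of the \<open>l\<close> unmatched men contributes
  \<open>y\<close>.\<close>

lemma sum_xh_affine:
  "(\<Sum>m<n. xh x m * (1 - \<zeta> m + y * \<zeta> m)) = s x * (1 - z + z * y) + l * y"
proof -
  have "(\<Sum>m<n. xh x m * (1 - \<zeta> m + y * \<zeta> m))
    = (\<Sum>m\<in>{..<n} - D. xh x m * (1 - \<zeta> m + y * \<zeta> m)) + (\<Sum>m\<in>D. xh x m * (1 - \<zeta> m + y * \<zeta> m))"
    by (rule sum.subset_diff) (use D in auto)
  also have "(\<Sum>m\<in>{..<n} - D. xh x m * (1 - \<zeta> m + y * \<zeta> m)) = (\<Sum>m\<in>{..<n} - D. y)"
    by (intro sum.cong) (auto simp: xh_def \<zeta>_def)
  also have "\<dots> = l * y" using D by (simp add: l_def card_Diff_subset)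
  also have "(\<Sum>m\<in>D. xh x m * (1 - \<zeta> m + y * \<zeta> m)) = (\<Sum>m\<in>D. x m * (1 - z + z * y))"
    by (intro sum.cong) (auto simp: xh_def \<zeta>_def)
  also have "\<dots> = s x * (1 - z + z * y)" unfolding s_def by (rule sum_distrib_right[symmetric])
  finally show ?thesis by simp
qed

text \<open>Every factor equals 1 minus \<open>p\<close> times the summand, and \<open>1 + r\<close>
  is at most \<open>exp r\<close>. The set \<open>A\<close> is arbitrary so that a woman's own
  partner can be left out.\<close>

lemma prod_factor_le:
  assumes x: "x \<in> space (Pi\<^sub>M D (\<lambda>_. restrict_space lborel {0..1::real}))" and y: "0 \<le> y" "y \<le> 1"
  shows "(\<Prod>m\<in>A. y * (xh x m * c m True + (1 - xh x m)) + (1 - y) * (xh x m * c m False + (1 - xh x m)))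
    \<le> exp (- (p * (\<Sum>m\<in>A. xh x m * (1 - \<zeta> m + y * \<zeta> m))))"
proof -
  have "(\<Prod>m\<in>A. y * (xh x m * c m True + (1 - xh x m)) + (1 - y) * (xh x m * c m False + (1 - xh x m)))
    \<le> (\<Prod>m\<in>A. exp (- (p * (xh x m * (1 - \<zeta> m + y * \<zeta> m)))))"
  proof (intro prod_mono conjI)
    fix m
    show "0 \<le> y * (xh x m * c m True + (1 - xh x m)) + (1 - y) * (xh x m * c m False + (1 - xh x m))"
      using y unit_space[OF x, of m] c_nonneg
      by (intro add_nonneg_nonneg mult_nonneg_nonneg) auto
    have "y * (xh x m * c m True + (1 - xh x m)) + (1 - y) * (xh x m * c m False + (1 - xh x m))
      = 1 + (- (p * (xh x m * (1 - \<zeta> m + y * \<zeta> m))))"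
      unfolding c_def by (simp add: algebra_simps)
    also have "\<dots> \<le> exp (- (p * (xh x m * (1 - \<zeta> m + y * \<zeta> m))))" by (rule exp_ge_add_one_self)
    finally show "y * (xh x m * c m True + (1 - xh x m)) + (1 - y) * (xh x m * c m False + (1 - xh x m))
      \<le> exp (- (p * (xh x m * (1 - \<zeta> m + y * \<zeta> m))))" .
  qed
  also have "\<dots> = exp (- (p * (\<Sum>m\<in>A. xh x m * (1 - \<zeta> m + y * \<zeta> m))))"
    by (cases "finite A") (simp_all add: exp_sum [symmetric] sum_distrib_left sum_negf)
  finally show ?thesis .
qed

text \<open>An unmatched woman would accept anyone, so the integrand does not depend on her list;
  this is the case \<open>y = 1\<close> of the factor bound.\<close>

lemma unmatched_woman_le:
  assumes x: "x \<in> space (Pi\<^sub>M D (\<lambda>_. restrict_space lborel {0..1::real}))" and w: "w < n" "w \<notin> R"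
  shows "(\<integral>\<^sup>+ys. ennreal (\<Prod>m<n. if m \<in> D \<and> w = h m then z * p
     else xh x m * c m (would_accept_w ys w m) + (1 - xh x m) * 1)
       \<partial>measure_pmf (pmf_of_set (permutations_of_set {..<n})))
    \<le> ennreal (exp (- (p * (s x + l))))"
proof -
  have "(\<Prod>m<n. if m \<in> D \<and> w = h m then z * p
     else xh x m * c m (would_accept_w ys w m) + (1 - xh x m) * 1)
    = (\<Prod>m<n. 1 * (xh x m * c m True + (1 - xh x m)) + (1 - 1) * (xh x m * c m False + (1 - xh x m)))" for ys
    using w by (intro prod.cong) (auto simp: would_accept_w_def R_def)
  moreover have "\<dots> \<le> exp (- (p * (\<Sum>m<n. xh x m * (1 - \<zeta> m + 1 * \<zeta> m))))"
    by (rule prod_factor_le[OF x]) auto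
  moreover have "(\<Sum>m<n. xh x m * (1 - \<zeta> m + 1 * \<zeta> m)) = s x + l"
    using sum_xh_affine[of x 1] by simp
  ultimately show ?thesis
    by (simp add: measure_pmf.emeasure_space_1 ennreal_leI)
qed

text \<open>The mixture lemma gives her a uniform variable \<open>y\<close>. Leaving out her partner
  costs \<open>exp (p * x (g w))\<close>; over all matched women these costs multiply to
  \<open>exp (p * s x)\<close>. The factor with \<open>1 - z\<close> is the gain from weighting the
  ranks.\<close>

lemma matched_woman_le:
  assumes x: "x \<in> space (Pi\<^sub>M D (\<lambda>_. restrict_space lborel {0..1::real}))" and w: "w \<in> R" and a: "0 < a"
  shows "(\<integral>\<^sup>+ys. ennreal (\<Prod>m<n. if m \<in> D \<and> w = h m then z * p
     else xh x m * c m (would_accept_w ys w m) + (1 - xh x m) * 1)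
       \<partial>measure_pmf (pmf_of_set (permutations_of_set {..<n})))
    \<le> ennreal (p * exp (p * x (g w) - p * (1 - z) * s x) *
        (exp a * ((1 - exp (- (p * (s x + l) + a))) / (p * (s x + l) + a))))"
proof -
  let ?U = "restrict_space lborel {0..1::real}"
  define v where "v = g w"
  have v: "v \<in> D" "v < n" "h v = w" unfolding v_def using g w D by auto
  have v_iff: "m \<in> D \<and> w = h m \<longleftrightarrow> m = v" for m
    using v inj by (auto dest: inj_onD)
  have xv: "0 \<le> x v" "x v \<le> 1" using unit_space[OF x, of v] v unfolding xh_def by auto
  define ct cf where "ct m = xh x m * c m True + (1 - xh x m)" and "cf m = xh x m * c m False + (1 - xh x m)" for m
  have ct: "ct m \<ge> 0" "cf m \<ge> 0" for m
    unfolding ct_def cf_def using unit_space[OF x, of m] c_nonneg by auto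
  have "(\<Prod>m<n. if m \<in> D \<and> w = h m then z * p
     else xh x m * c m (would_accept_w ys w m) + (1 - xh x m) * 1)
    = z * p * (\<Prod>m\<in>{..<n} - {v}. if prefers ys m v then ct m else cf m)" for ys
  proof -
    have "(\<Prod>m<n. if m = v then z * p else xh x m * c m (would_accept_w ys w m) + (1 - xh x m) * 1)
      = z * p * (\<Prod>m\<in>{..<n} - {v}. if m = v then z * p else xh x m * c m (would_accept_w ys w m) + (1 - xh x m) * 1)"
      using v by (subst prod.remove[of _ v]) auto
    also have "(\<Prod>m\<in>{..<n} - {v}. if m = v then z * p else xh x m * c m (would_accept_w ys w m) + (1 - xh x m) * 1)
      = (\<Prod>m\<in>{..<n} - {v}. if prefers ys m v then ct m else cf m)"
      using w by (intro prod.cong) (auto simp: would_accept_w_def ct_def cf_def v_def)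
    finally show ?thesis unfolding v_iff .
  qed
  then have "(\<integral>\<^sup>+ys. ennreal (\<Prod>m<n. if m \<in> D \<and> w = h m then z * p
     else xh x m * c m (would_accept_w ys w m) + (1 - xh x m) * 1)
       \<partial>measure_pmf (pmf_of_set (permutations_of_set {..<n})))
    = ennreal (z * p) * (\<integral>\<^sup>+ys. ennreal (\<Prod>m\<in>{..<n} - {v}. if prefers ys m v then ct m else cf m)
       \<partial>measure_pmf (pmf_of_set (permutations_of_set {..<n})))"
    using z p by (simp add: ennreal_mult' nn_integral_cmult)
  also have "\<dots> = ennreal (z * p) * (\<integral>\<^sup>+y. ennreal (\<Prod>m\<in>{..<n} - {v}. y * ct m + (1 - y) * cf m) \<partial>?U)"
    using v ct by (subst nn_integral_prefers_mixture) auto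
  also have "\<dots> \<le> ennreal (z * p) * (\<integral>\<^sup>+y. ennreal (exp (p * x v - p * (1 - z) * s x)) *
      ennreal (exp (- (z * (p * (s x + l)) * y))) \<partial>?U)"
  proof (intro mult_left_mono nn_integral_mono)
    fix y assume "y \<in> space ?U"
    then have y: "0 \<le> y" "y \<le> 1" by (auto simp: space_restrict_space)
    have "(\<Prod>m\<in>{..<n} - {v}. y * ct m + (1 - y) * cf m)
      \<le> exp (- (p * (\<Sum>m\<in>{..<n} - {v}. xh x m * (1 - \<zeta> m + y * \<zeta> m))))"
      unfolding ct_def cf_def by (rule prod_factor_le[OF x y])
    also have "(\<Sum>m\<in>{..<n} - {v}. xh x m * (1 - \<zeta> m + y * \<zeta> m))
      = s x * (1 - z + z * y) + l * y - x v * (1 - z + y * z)"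
      using sum_xh_affine[of x y] v by (simp add: sum.remove[of _ v] xh_def \<zeta>_def)
    also have "exp (- (p * (s x * (1 - z + z * y) + l * y - x v * (1 - z + y * z))))
      \<le> exp (p * x v - p * (1 - z) * s x + - (z * (p * (s x + l)) * y))"
    proof -
      have "1 - z + y * z \<le> 1" using y z mult_right_mono[of y 1 z] by simp
      then have "x v * (1 - z + y * z) \<le> x v" using xv by (simp add: mult_left_le)
      \<comment> \<open>The weakening lets \<open>s x\<close> and \<open>l\<close> share the rate
        \<open>z * p * (s x + l)\<close> in \<open>y\<close>.\<close>
      moreover have "z * (l * y) \<le> l * y" using l y z mult_right_mono[of z 1 "l * y"] by simp
      ultimately have "s x * (1 - z + z * y) + z * (l * y) - x v \<le> s x * (1 - z + z * y) + l * y - x v * (1 - z + y * z)"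
        by linarith
      then have "p * (s x * (1 - z + z * y) + z * (l * y) - x v) \<le> p * (s x * (1 - z + z * y) + l * y - x v * (1 - z + y * z))"
        using p by (intro mult_left_mono) auto
      then show ?thesis by (simp add: algebra_simps)
    qed
    finally show "ennreal (\<Prod>m\<in>{..<n} - {v}. y * ct m + (1 - y) * cf m) \<le>
        ennreal (exp (p * x v - p * (1 - z) * s x)) * ennreal (exp (- (z * (p * (s x + l)) * y)))"
      by (simp only: exp_add) (simp add: ennreal_mult [symmetric] ennreal_leI)
  qed auto
  also have "\<dots> = ennreal (p * exp (p * x v - p * (1 - z) * s x)) *
      (\<integral>\<^sup>+y. ennreal (z * exp (- (z * (p * (s x + l)) * y))) \<partial>?U)"
  proof -
    have m: "(\<lambda>y. ennreal (exp (- (z * (p * (s x + l)) * y)))) \<in> borel_measurable ?U"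
      by (rule measurable_restrict_space1) simp
    have J: "(\<integral>\<^sup>+y. ennreal (z * exp (- (z * (p * (s x + l)) * y))) \<partial>?U)
      = ennreal z * (\<integral>\<^sup>+y. ennreal (exp (- (z * (p * (s x + l)) * y))) \<partial>?U)"
      unfolding nn_integral_cmult[OF m, symmetric]
      using z by (intro nn_integral_cong ennreal_mult) auto
    have e: "ennreal (z * p) = ennreal z * ennreal p" 
      "ennreal (p * exp (p * x v - p * (1 - z) * s x)) = ennreal p * ennreal (exp (p * x v - p * (1 - z) * s x))"
      using z p by (auto intro: ennreal_mult)
    show ?thesis
      unfolding J e nn_integral_cmult[OF m] by (simp only: mult_ac)
  qed
  also have "\<dots> \<le> ennreal (p * exp (p * x v - p * (1 - z) * s x)) *
      ennreal (exp a * ((1 - exp (- (p * (s x + l) + a))) / (p * (s x + l) + a)))"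
    using p s_nonneg[OF x] l by (intro mult_left_mono nn_integral_exp_unit_interval_le z a mult_nonneg_nonneg) auto
  also have "\<dots> = ennreal (p * exp (p * x v - p * (1 - z) * s x) *
      (exp a * ((1 - exp (- (p * (s x + l) + a))) / (p * (s x + l) + a))))"
    by (rule ennreal_mult' [symmetric]) (use p in simp)
  finally show ?thesis unfolding v_def .
qed

section \<open>Integration over the cube and the exponential Markov inequality\<close>

lemma bound_nonneg:
  assumes "\<And>u. 0 < u \<Longrightarrow> exp (u - (1 - z) * real (card D) * u - l * (u + p * l)) *
      ((1 - exp (- (u + p * l))) / (u + p * l)) ^ card D * u ^ (card D + 1) \<le> B"
  shows "0 \<le> B"
proof -
  define t where "t = 1 + p * l"
  have "t > 0" unfolding t_def using p l(2) by (simp add: add_pos_nonneg)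
  then have "0 \<le> exp (1 - (1 - z) * real (card D) * 1 - l * t) * ((1 - exp (- t)) / t) ^ card D * 1 ^ (card D + 1)"
    by (intro mult_nonneg_nonneg zero_le_power divide_nonneg_nonneg) auto
  also have "\<dots> \<le> B" unfolding t_def by (rule assms) simp
  finally show ?thesis .
qed

text \<open>With \<open>u = p * s x + a\<close> the integrand is at most a constant times
  \<open>B / u ^ (card D + 1)\<close>, and the integral of this power over the cube is already
  bounded. The factors \<open>p ^ card D\<close> cancel.\<close>

lemma nn_integral_wt_le:
  assumes a: "0 < a" "a * real n \<le> 1"
    and B: "\<And>u. 0 < u \<Longrightarrow> exp (u - (1 - z) * real (card D) * u - l * (u + p * l)) *
      ((1 - exp (- (u + p * l))) / (u + p * l)) ^ card D * u ^ (card D + 1) \<le> B"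
  shows "(\<integral>\<^sup>+I. ennreal (case I of (mp, wp, adm) \<Rightarrow> \<Prod>e\<in>{..<n} \<times> {..<n}. wt mp wp e (adm e))
      \<partial>measure_pmf (random_instance n p))
    \<le> ennreal (exp 2 * B / (fact (card D) * a))"
proof -
  let ?U = "restrict_space lborel {0..1::real}"
  let ?V = "Pi\<^sub>M D (\<lambda>_. ?U)"
  let ?P = "random_prefs n"
  let ?Q = "pmf_of_set (permutations_of_set {..<n})"
  define k where "k = card D"
  define \<Phi> where "\<Phi> mp wp = (\<Prod>m<n. \<Prod>w<n. if m \<in> D \<and> w = h m then z * p
        else if would_accept_m (mp m) m w then c m (would_accept_w (wp w) w m) else 1)" for mp wp :: prefs
  note B0 = bound_nonneg[OF B]
  have meas: "(\<lambda>x. ennreal (\<Prod>m<n. G wp m (xh x m))) \<in> borel_measurable ?V" for wp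
  proof -
    have "(\<lambda>x. G wp m (xh x m)) \<in> borel_measurable ?V" for m
      by (cases "m \<in> D") (auto simp: xh_def intro: measurable_compose[OF component_measurable_unit_interval G_measurable])
    then show ?thesis by (intro measurable_compose[OF _ measurable_ennreal] borel_measurable_prod)
  qed
  have "(\<integral>\<^sup>+I. ennreal (case I of (mp, wp, adm) \<Rightarrow> \<Prod>e\<in>{..<n} \<times> {..<n}. wt mp wp e (adm e))
      \<partial>measure_pmf (random_instance n p))
    = (\<integral>\<^sup>+mp. \<integral>\<^sup>+wp. ennreal (\<Phi> mp wp) \<partial>measure_pmf ?P \<partial>measure_pmf ?P)"
    unfolding random_instance_def nn_integral_pair_pmf' prod.case nn_integral_admissibility \<Phi>_def ..
  \<comment> \<open>The men's lists are averaged for fixed women's lists. A second swap then puts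
    the cube outside, so that the women's lists can be averaged for fixed \<open>x\<close>.\<close>
  also have "\<dots> = (\<integral>\<^sup>+wp. \<integral>\<^sup>+mp. ennreal (\<Phi> mp wp) \<partial>measure_pmf ?P \<partial>measure_pmf ?P)"
    by (rule nn_integral_pmf_swap) (simp_all add: finite_set_random_prefs)
  also have "\<dots> = (\<integral>\<^sup>+wp. \<integral>\<^sup>+x. ennreal (\<Prod>m<n. G wp m (xh x m)) \<partial>?V \<partial>measure_pmf ?P)"
    unfolding \<Phi>_def nn_integral_men_prefs ..
  also have "\<dots> = (\<integral>\<^sup>+x. \<integral>\<^sup>+wp. ennreal (\<Prod>m<n. G wp m (xh x m)) \<partial>measure_pmf ?P \<partial>?V)"
    by (rule nn_integral_pmf_swap) (simp_all add: finite_set_random_prefs meas)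
  also have "\<dots> \<le> (\<integral>\<^sup>+x. ennreal (p ^ k * exp 2 * B) * ennreal (inverse ((p * (\<Sum>i\<in>D. x i) + a) ^ (card D + 1))) \<partial>?V)"
  proof (rule nn_integral_mono)
    fix x assume x: "x \<in> space ?V"
    define u t where "u = p * s x + a" and "t = u + p * l"
    have sx: "0 \<le> s x" by (rule s_nonneg[OF x])
    have u: "u > 0" unfolding u_def using p a sx by (simp add: add_nonneg_pos)
    have ta: "p * (s x + l) + a = t" unfolding t_def u_def by (simp add: algebra_simps)
    have t: "t > 0" unfolding t_def using u p l by (simp add: add_pos_nonneg)
    define \<phi> where "\<phi> = (1 - exp (- t)) / t"
    have \<phi>: "\<phi> \<ge> 0" unfolding \<phi>_def using t by simp
    define b1 where "b1 w = p * exp (p * x (g w) - p * (1 - z) * s x) * (exp a * \<phi>)" for w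
    define b2 where "b2 = exp (- (p * (s x + l)))"
    have b: "b1 w \<ge> 0" "b2 \<ge> 0" for w unfolding b1_def b2_def using p \<phi> by auto
    have "(\<integral>\<^sup>+wp. ennreal (\<Prod>m<n. G wp m (xh x m)) \<partial>measure_pmf ?P) \<le> (\<Prod>w<n. ennreal (if w \<in> R then b1 w else b2))"
      unfolding nn_integral_women_prefs[OF x]
    proof (intro prod_mono_ennreal)
      fix w assume "w \<in> {..<n}"
      then show "(\<integral>\<^sup>+ys. ennreal (\<Prod>m<n. if m \<in> D \<and> w = h m then z * p
         else xh x m * c m (would_accept_w ys w m) + (1 - xh x m) * 1) \<partial>measure_pmf ?Q)
         \<le> ennreal (if w \<in> R then b1 w else b2)"
        using matched_woman_le[OF x _ a(1), of w] unmatched_woman_le[OF x, of w]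
        unfolding ta b1_def b2_def \<phi>_def by auto
    qed
    also have "\<dots> = ennreal (\<Prod>w<n. if w \<in> R then b1 w else b2)"
      using b by (intro prod_ennreal) auto
    also have "(\<Prod>w<n. if w \<in> R then b1 w else b2) = (\<Prod>w\<in>R. b1 w) * b2 ^ (n - k)"
      using R by (simp add: prod.If_cases Int_absorb1 Diff_eq [symmetric] card_Diff_subset card_R k_def)
    also have "(\<Prod>w\<in>R. b1 w) = p ^ k * exp (p * s x - real k * (p * (1 - z) * s x)) * (exp (real k * a) * \<phi> ^ k)"
    proof -
      have "(\<Sum>w\<in>R. p * x (g w) - p * (1 - z) * s x) = p * s x - real k * (p * (1 - z) * s x)"
      proof -
        have "(\<Sum>w\<in>R. x (g w)) = s x"
          unfolding R_def s_def by (subst sum.reindex[OF inj]) (simp add: g)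
        then show ?thesis by (simp add: sum_subtractf card_R k_def sum_distrib_left [symmetric])
      qed
      then have "(\<Prod>w\<in>R. exp (p * x (g w) - p * (1 - z) * s x)) = exp (p * s x - real k * (p * (1 - z) * s x))"
        by (simp add: exp_sum [symmetric])
      then show ?thesis
        unfolding b1_def by (simp add: prod.distrib card_R k_def power_mult_distrib exp_of_nat_mult)
    qed
    also have "b2 ^ (n - k) = exp (- (l * (p * (s x + l))))"
      unfolding b2_def l_def k_def by (simp add: exp_of_nat_mult [symmetric])
    also have "p ^ k * exp (p * s x - real k * (p * (1 - z) * s x)) * (exp (real k * a) * \<phi> ^ k) *
        exp (- (l * (p * (s x + l))))
      = p ^ k * exp (p * s x - real k * (p * (1 - z) * s x) + real k * a + - (l * (p * (s x + l)))) * \<phi> ^ k"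
      by (simp only: exp_add mult_ac)
    \<comment> \<open>Replacing \<open>p * s x\<close> by \<open>u\<close> changes the exponent by
      multiples of \<open>a\<close>. Since \<open>a * n\<close> is at most 1, the terms from
      \<open>k * a + l * a\<close> and from \<open>(1 - z) * k * a\<close> cost at most 1
      each.\<close>
    also have "\<dots> \<le> p ^ k * exp (2 + (u - (1 - z) * real k * u - l * t)) * \<phi> ^ k"
    proof -
      have "real k * a + l * a = a * real n" unfolding k_def l by (simp add: algebra_simps)
      moreover have "(1 - z) * real k * a \<le> a * real n"
      proof -
        have "(1 - z) * real k \<le> 1 * real n"
          using z card_D_le unfolding k_def by (intro mult_mono) auto
        then show ?thesis using a mult_right_mono[of "(1 - z) * real k" "real n" a] by (simp add: mult_ac)
      qed
      moreover have "u - (1 - z) * real k * u - l * t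
        = p * s x - real k * (p * (1 - z) * s x) - l * (p * (s x + l)) + a - (1 - z) * real k * a - l * a"
        unfolding t_def u_def by (simp add: algebra_simps)
      ultimately have "p * s x - real k * (p * (1 - z) * s x) + real k * a + - (l * (p * (s x + l)))
        \<le> 2 + (u - (1 - z) * real k * u - l * t)"
        using a by linarith
      then show ?thesis using p \<phi> by (intro mult_right_mono mult_left_mono) auto
    qed
    also have "\<dots> = p ^ k * exp 2 * (exp (u - (1 - z) * real k * u - l * t) * \<phi> ^ k)"
      by (simp add: exp_add)
    also have "\<dots> \<le> p ^ k * exp 2 * (B * inverse (u ^ (k + 1)))"
    proof -
      have "exp (u - (1 - z) * real k * u - l * t) * \<phi> ^ k * u ^ (k + 1) \<le> B"
        using B[OF u] unfolding t_def \<phi>_def k_def .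
      then have "exp (u - (1 - z) * real k * u - l * t) * \<phi> ^ k \<le> B * inverse (u ^ (k + 1))"
        using u by (simp only: divide_inverse [symmetric] pos_le_divide_eq zero_less_power)
      then show ?thesis using p by (intro mult_left_mono) auto
    qed
    also have "p ^ k * exp 2 * (B * inverse (u ^ (k + 1))) = p ^ k * exp 2 * B * inverse (u ^ (k + 1))"
      by simp
    also have "ennreal \<dots> = ennreal (p ^ k * exp 2 * B) * ennreal (inverse (u ^ (k + 1)))"
      using p B0 u by (intro ennreal_mult) auto
    finally show "(\<integral>\<^sup>+wp. ennreal (\<Prod>m<n. G wp m (xh x m)) \<partial>measure_pmf ?P)
      \<le> ennreal (p ^ k * exp 2 * B) * ennreal (inverse ((p * (\<Sum>i\<in>D. x i) + a) ^ (card D + 1)))"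
      unfolding u_def s_def k_def by (simp add: ennreal_leI)
  qed
  also have "\<dots> = ennreal (p ^ k * exp 2 * B) * (\<integral>\<^sup>+x. ennreal (inverse ((p * (\<Sum>i\<in>D. x i) + a) ^ (card D + 1))) \<partial>?V)"
  proof (rule nn_integral_cmult)
    note component_measurable_unit_interval [measurable]
    show "(\<lambda>x. ennreal (inverse ((p * (\<Sum>i\<in>D. x i) + a) ^ (card D + 1)))) \<in> borel_measurable ?V"
      by measurable
  qed
  also have "\<dots> \<le> ennreal (p ^ k * exp 2 * B) * ennreal (1 / (p ^ card D * fact (card D) * a))"
    by (intro mult_left_mono nn_integral_inverse_sum_power_le p a fin) simp
  also have "\<dots> = ennreal (p ^ k * exp 2 * B * (1 / (p ^ card D * fact (card D) * a)))"
    using p B0 a by (intro ennreal_mult [symmetric]) auto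
  also have "p ^ k * exp 2 * B * (1 / (p ^ card D * fact (card D) * a)) = exp 2 * B / (fact (card D) * a)"
    unfolding k_def using p by simp
  finally show ?thesis .
qed

text \<open>As \<open>z\<close> is at most 1, a total below \<open>q\<close> forces
  \<open>z ^ Q\<close> to be at least \<open>z powr q\<close>, so the indicator is at most
  \<open>z powr (- q)\<close> times the product of weights. Distinctness is part of the event
  because the product formula relies on it.\<close>

lemma prob_stable_le:
  assumes a: "0 < a" "a * real n \<le> 1"
    and B: "\<And>u. 0 < u \<Longrightarrow> exp (u - (1 - z) * real (card D) * u - l * (u + p * l)) *
      ((1 - exp (- (u + p * l))) / (u + p * l)) ^ card D * u ^ (card D + 1) \<le> B"
  shows "measure_pmf.prob (random_instance n p)
      {I. (\<forall>m<n. distinct (fst I m)) \<and> stable_matching n I M \<and> real (total_wife_rank n I M) < q}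
    \<le> z powr (- q) * (exp 2 * B / (fact (card D) * a))"
proof -
  let ?E = "{I. (\<forall>m<n. distinct (fst I m)) \<and> stable_matching n I M \<and> real (total_wife_rank n I M) < q}"
  define W where "W I = (case I of (mp, wp, adm) \<Rightarrow> \<Prod>e\<in>{..<n} \<times> {..<n}. wt mp wp e (adm e))" for I
  note B0 = bound_nonneg[OF B]
  have "emeasure (measure_pmf (random_instance n p)) ?E = (\<integral>\<^sup>+I. indicator ?E I \<partial>measure_pmf (random_instance n p))"
    by simp
  also have "\<dots> \<le> (\<integral>\<^sup>+I. ennreal (z powr (- q)) * ennreal (W I) \<partial>measure_pmf (random_instance n p))"
  proof (rule nn_integral_mono)
    fix I
    show "indicator ?E I \<le> ennreal (z powr (- q)) * ennreal (W I)"
    proof (cases "I \<in> ?E")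
      case True
      obtain mp wp adm where I: "I = (mp, wp, adm)" by (cases I)
      have "W I = z ^ total_wife_rank n I M"
        unfolding W_def I prod.case using True by (intro prod_wt_stable) (auto simp: I)
      also have "\<dots> = z powr (real (total_wife_rank n I M))" using z by (simp add: powr_realpow)
      also have "\<dots> \<ge> z powr q" using True z by (intro powr_mono') auto
      finally have "z powr (- q) * z powr q \<le> z powr (- q) * W I" by (intro mult_left_mono) auto
      then have "1 \<le> z powr (- q) * W I" using z by (simp add: powr_add [symmetric])
      then have "ennreal 1 \<le> ennreal (z powr (- q) * W I)" by (rule ennreal_leI)
      then show ?thesis using True by (simp add: ennreal_mult')
    qed simp
  qed
  also have "\<dots> = ennreal (z powr (- q)) * (\<integral>\<^sup>+I. ennreal (W I) \<partial>measure_pmf (random_instance n p))"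
    by (rule nn_integral_cmult) simp
  also have "\<dots> \<le> ennreal (z powr (- q)) * ennreal (exp 2 * B / (fact (card D) * a))"
    unfolding W_def by (intro mult_left_mono nn_integral_wt_le a B) auto
  also have "\<dots> = ennreal (z powr (- q) * (exp 2 * B / (fact (card D) * a)))"
    by (rule ennreal_mult' [symmetric]) simp
  finally show ?thesis
    using B0 a by (simp add: measure_pmf.emeasure_eq_measure)
qed

end

section \<open>The decay of the summands\<close>

text \<open>Here \<open>Z\<close> stands for the logarithm of \<open>z powr (- q)\<close>. What
  holds only for large \<open>n\<close> is collected in hypotheses free of \<open>p\<close>,
  \<open>k\<close> and \<open>u\<close>: \<open>B\<close> and \<open>B2\<close> serve the case of
  many unmatched men, \<open>A1\<close>, \<open>A2\<close> and \<open>A3\<close> the three subcases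
  with few. The target \<open>1 / n ^ 3\<close> leaves room for a factor \<open>n\<close> from the
  shift \<open>a = 1 / n\<close> and for \<open>n + 1\<close> matching sizes.\<close>

lemma matching_weight_bound_aux:
  fixes n k :: nat and p u \<epsilon> Z :: real
  defines "L \<equiv> ln (real n)" and "l \<equiv> real (n - k)"
  defines "t \<equiv> u + p * l"
  assumes \<epsilon>: "0 < \<epsilon>" "\<epsilon> < 1" and p: "0 < p" "9 / 4 * L\<^sup>2 \<le> p * real n"
    and k: "k \<le> n" and u: "0 < u" and L: "0 < L"
    and Z: "Z \<le> (1 - \<epsilon>) * L\<^sup>2 + 1"
    and B: "real n * ln 4 + L\<^sup>2 + 1 - 9 / 4 * (\<epsilon> / 8)\<^sup>2 * L\<^sup>2 * real n \<le> - 3 * L"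
    and B2: "\<epsilon> / 8 * real n \<ge> 2"
    and A1: "L\<^sup>2 + 1 + 2 * L - 7 / 8 * real n powr (\<epsilon> / 2) \<le> - 3 * L"
    and A2: "2 \<le> (1 - \<epsilon> / 8) * L"
      "(1 - \<epsilon>) * L\<^sup>2 + 1 + (1 - 3 * \<epsilon> / 4) * L * (2 - (1 - \<epsilon> / 8) * L) \<le> - 3 * L"
    and A3: "L\<^sup>2 + 1 + 2 * L - 7 / 128 * real n * \<epsilon> \<le> - 3 * L"
  shows "real (n choose k) ^ 2 * exp Z *
    (exp (u - L / real n * real k * u - l * t) * ((1 - exp (- t)) / t) ^ k * u ^ (k + 1))
    \<le> 1 / real n ^ 3"
proof -
  define \<eta> v w where "\<eta> = L / real n" and "v = u / t" and "w = 1 - exp (- t)"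
  have "n \<noteq> 0" using L unfolding L_def by (intro notI) simp
  then have n: "real n > 1" using L unfolding L_def by simp
  have l: "l \<ge> 0" "real k = real n - l" unfolding l_def using k by auto
  have t: "t > 0" unfolding t_def using u p l by (simp add: add_pos_nonneg)
  have tu: "t \<ge> u" unfolding t_def using p l by simp
  have v: "0 < v" "v \<le> 1" unfolding v_def using t tu u by auto
  have w: "0 < w" "w \<le> 1" unfolding w_def using t by auto
  have \<eta>: "\<eta> > 0" unfolding \<eta>_def using L n by simp
  \<comment> \<open>Absorbs the surplus factor of \<open>u ^ (k + 1)\<close>, so that only
    \<open>(u / t) ^ k\<close> remains; this is why \<open>2 * u\<close> appears in the
    exponent.\<close>
  have "u \<le> exp u" using exp_ge_add_one_self[of u] by linarith
  then have "exp (u - \<eta> * real k * u - l * t) * u \<le> exp (u - \<eta> * real k * u - l * t) * exp u"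
    by simp
  also have "\<dots> = exp (2 * u - \<eta> * real k * u - l * t)"
    by (simp add: exp_add [symmetric])
  finally have e1: "exp (u - \<eta> * real k * u - l * t) * u \<le> exp (2 * u - \<eta> * real k * u - l * t)" .
  have "real (n choose k) ^ 2 * exp Z *
    (exp (u - \<eta> * real k * u - l * t) * ((1 - exp (- t)) / t) ^ k * u ^ (k + 1))
    = real (n choose k) ^ 2 * (exp Z * (exp (u - \<eta> * real k * u - l * t) * u) * (v ^ k * w ^ k))"
    unfolding v_def w_def by (simp add: power_divide field_simps)
  also have "\<dots> \<le> real (n choose k) ^ 2 *
      (exp Z * exp (2 * u - \<eta> * real k * u - l * t) * (v ^ k * w ^ k))"
    using v w by (intro mult_left_mono mult_right_mono e1) auto
  also have "exp Z * exp (2 * u - \<eta> * real k * u - l * t) = exp (Z + 2 * u - \<eta> * real k * u - l * t)"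
    by (simp add: exp_add [symmetric])
  finally have le1: "real (n choose k) ^ 2 * exp Z *
    (exp (u - \<eta> * real k * u - l * t) * ((1 - exp (- t)) / t) ^ k * u ^ (k + 1))
    \<le> real (n choose k) ^ 2 * (exp (Z + 2 * u - \<eta> * real k * u - l * t) * (v ^ k * w ^ k))" .
  have Z': "Z \<le> L\<^sup>2 + 1"
  proof -
    have "0 \<le> \<epsilon> * L\<^sup>2" using \<epsilon> by simp
    with Z show ?thesis by (simp add: algebra_simps)
  qed
  have "real (n choose k) ^ 2 * (exp (Z + 2 * u - \<eta> * real k * u - l * t) * (v ^ k * w ^ k))
    \<le> exp (- 3 * L)"
  proof (cases "l \<ge> \<epsilon> / 8 * real n")
    \<comment> \<open>Many unmatched men: the crude bound \<open>2 ^ n\<close> on the binomial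
      coefficient suffices. In \<open>l * t\<close> the part \<open>l * u\<close> pays for
      \<open>2 * u\<close>, and \<open>p * l ^ 2\<close>, of order at least
      \<open>n * L ^ 2\<close>, pays for the rest.\<close>
    case True
    have "real (n choose k) \<le> 2 ^ n"
    proof -
      have "(n choose k) \<le> 2 ^ n" using binomial_le_pow2 by blast
      then have "real (n choose k) \<le> real (2 ^ n)" by (simp only: of_nat_le_iff)
      then show ?thesis by simp
    qed
    then have "real (n choose k) ^ 2 \<le> (2 ^ n) ^ 2" by (intro power_mono) auto
    also have "\<dots> = exp (real n * ln 4)"
      by (simp add: exp_of_nat_mult power_mult [symmetric] mult.commute[of n 2] power_mult[of 2 2 n])
    finally have C: "real (n choose k) ^ 2 \<le> exp (real n * ln 4)" .
    have vw: "v ^ k * w ^ k \<le> 1" using v w by (intro mult_le_one power_le_one) auto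
    have "real (n choose k) ^ 2 * (exp (Z + 2 * u - \<eta> * real k * u - l * t) * (v ^ k * w ^ k))
      \<le> exp (real n * ln 4) * (exp (Z + 2 * u - \<eta> * real k * u - l * t) * 1)"
      using v w by (intro mult_mono C vw order_refl) auto
    also have "\<dots> = exp (real n * ln 4 + Z + 2 * u - \<eta> * real k * u - l * t)"
      by (simp add: exp_add [symmetric] algebra_simps)
    also have "\<dots> \<le> exp (- 3 * L)"
    proof -
      have "2 \<le> l" using True B2 by linarith
      then have "2 * u \<le> l * u" using u by simp
      moreover have "l * t = l * u + p * l\<^sup>2" unfolding t_def by (simp add: algebra_simps power2_eq_square)
      moreover have "\<eta> * real k * u \<ge> 0" using \<eta> u by simp
      moreover have "9 / 4 * (\<epsilon> / 8)\<^sup>2 * L\<^sup>2 * real n \<le> p * l\<^sup>2"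
      proof -
        have "9 / 4 * (\<epsilon> / 8)\<^sup>2 * L\<^sup>2 * real n = (9 / 4 * L\<^sup>2) * ((\<epsilon> / 8)\<^sup>2 * real n)" by simp
        also have "\<dots> \<le> (p * real n) * ((\<epsilon> / 8)\<^sup>2 * real n)"
          by (intro mult_right_mono p) auto
        also have "\<dots> = p * (\<epsilon> / 8 * real n)\<^sup>2" by (simp add: power2_eq_square)
        also have "\<dots> \<le> p * l\<^sup>2"
          using True \<epsilon> p by (intro mult_left_mono power_mono) auto
        finally show ?thesis .
      qed
      ultimately show ?thesis using B Z' by simp
    qed
    finally show ?thesis .
  next
    case False
    have kn: "real k \<ge> (1 - \<epsilon> / 8) * real n" using False l by (simp add: algebra_simps)
    have kn': "real k \<ge> 7 / 8 * real n"
    proof -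
      have "7 / 8 * real n \<le> (1 - \<epsilon> / 8) * real n" using \<epsilon> by (intro mult_right_mono) auto
      with kn show ?thesis by linarith
    qed
    \<comment> \<open>Few unmatched men: the binomial coefficients now have to be bounded in terms
      of \<open>l\<close>, so that they vanish for perfect matchings.\<close>
    have "(n choose k) \<le> n ^ (n - k)"
      using binomial_symmetric[OF k] binomial_le_pow[of "n - k" n] by simp
    then have "real (n choose k) \<le> real (n ^ (n - k))" by (simp only: of_nat_le_iff)
    also have "\<dots> = exp (l * L)" unfolding L_def l_def using n by (simp add: exp_of_nat_mult)
    finally have "real (n choose k) ^ 2 \<le> exp (l * L) ^ 2" by (intro power_mono) auto
    also have "\<dots> = exp (2 * l * L)" by (simp add: exp_double [symmetric] algebra_simps)
    finally have C: "real (n choose k) ^ 2 \<le> exp (2 * l * L)" .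
    have vk: "v ^ k = exp (real k * ln v)" using v by (simp add: exp_of_nat_mult)
    have wk: "w ^ k \<le> exp (- (real k * exp (- t)))"
    proof -
      have "w \<le> exp (- exp (- t))" unfolding w_def using exp_ge_add_one_self[of "- exp (- t)"] by simp
      then have "w ^ k \<le> exp (- exp (- t)) ^ k" using w by (intro power_mono) auto
      then show ?thesis by (simp add: exp_of_nat_mult [symmetric])
    qed
    have "real (n choose k) ^ 2 * (exp (Z + 2 * u - \<eta> * real k * u - l * t) * (v ^ k * w ^ k))
      \<le> exp (2 * l * L) * (exp (Z + 2 * u - \<eta> * real k * u - l * t) *
          (exp (real k * ln v) * exp (- (real k * exp (- t)))))"
      unfolding vk using w wk by (intro mult_mono C order_refl) auto
    also have "\<dots> = exp (2 * l * L + Z + 2 * u - \<eta> * real k * u - l * t + real k * ln v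
        - real k * exp (- t))"
      by (simp add: exp_add [symmetric] algebra_simps)
    also have "\<dots> \<le> exp (- 3 * L)"
    proof -
      have lnv: "ln v \<le> 0" using v by simp
      txt \<open>AM-GM for \<open>t\<close> and \<open>k p / t\<close>, whose product is about \<open>9/4 L\<^sup>2\<close>, absorbs the binomial coefficients.\<close>
      have "2 * l * L - l * t + 3 / 4 * (real k * ln v) \<le> 0"
      proof -
        have "ln v \<le> v - 1" using ln_le_minus_one[OF v(1)] .
        also have "\<dots> = - (p * l / t)" unfolding v_def using t by (simp add: t_def field_simps)
        finally have "3 / 4 * (real k * ln v) \<le> 3 / 4 * (real k * (- (p * l / t)))"
          by (intro mult_left_mono) auto
        then have "2 * l * L - l * t + 3 / 4 * (real k * ln v)
            \<le> l / t * (2 * L * t - t\<^sup>2 - 3 / 4 * real k * p)"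
          using t by (simp add: field_simps power2_eq_square)
        also have "\<dots> \<le> 0"
        proof -
          have "7 / 8 * (9 / 4 * L\<^sup>2) \<le> 7 / 8 * (p * real n)" using p by simp
          also have "\<dots> = p * (7 / 8 * real n)" by simp
          also have "\<dots> \<le> p * real k" using kn' p by (intro mult_left_mono) auto
          finally have "63 / 32 * L\<^sup>2 \<le> p * real k" by simp
          moreover have "3 / 4 * real k * p = 3 / 4 * (p * real k)" by simp
          ultimately have "2 * L * t - t\<^sup>2 - 3 / 4 * real k * p \<le> 2 * L * t - t\<^sup>2 - L\<^sup>2"
            using zero_le_power2[of L] by linarith
          also have "\<dots> = - (L - t)\<^sup>2" by (simp add: power2_eq_square algebra_simps)
          also have "\<dots> \<le> 0" by simp
          finally show ?thesis using l t by (intro mult_nonneg_nonpos) auto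
        qed
        finally show ?thesis .
      qed
      then have main: "2 * l * L + Z + 2 * u - \<eta> * real k * u - l * t + real k * ln v - real k * exp (- t)
        \<le> Z + 2 * u - \<eta> * real k * u + 1 / 4 * (real k * ln v) - real k * exp (- t)"
        by simp
      have klnv: "real k * ln v \<le> 0" using lnv by (simp add: mult_nonneg_nonpos)
      have \<eta>ku: "\<eta> * real k * u \<ge> 0" using \<eta> u by simp
      have ke: "real k * exp (- t) \<ge> 0" by simp
      \<comment> \<open>The thresholds differ so that in the third case \<open>u / t\<close> is at
        most \<open>1 - \<epsilon> / 4\<close>. The one for \<open>u\<close> still lies above
        \<open>1 - \<epsilon>\<close>, by enough that the rank weight wins in the second
        case.\<close>
      consider "t \<le> (1 - \<epsilon> / 2) * L" | "u \<ge> (1 - 3 * \<epsilon> / 4) * L"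
        | "t > (1 - \<epsilon> / 2) * L" "u < (1 - 3 * \<epsilon> / 4) * L" by linarith
      then have "Z + 2 * u - \<eta> * real k * u + 1 / 4 * (real k * ln v) - real k * exp (- t) \<le> - 3 * L"
      proof cases
        case 1
        have "(1 - \<epsilon> / 2) * L \<le> L" using \<epsilon> L by simp
        with 1 have uL: "u \<le> L" using tu by linarith
        \<comment> \<open>The first case is decided by \<open>k * exp (- t)\<close>, which is at
          least of order \<open>n powr (\<epsilon> / 2)\<close> and beats every power of
          \<open>L\<close>.\<close>
        have "n powr (\<epsilon> / 2) = real n * exp (- ((1 - \<epsilon> / 2) * L))"
        proof -
          have "real n * exp (- ((1 - \<epsilon> / 2) * L)) = exp L * exp (- ((1 - \<epsilon> / 2) * L))"
            unfolding L_def using n by simp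
          also have "\<dots> = exp (\<epsilon> / 2 * L)" by (simp add: exp_add [symmetric] algebra_simps)
          finally show ?thesis unfolding powr_def L_def using n by simp
        qed
        also have "\<dots> \<le> real n * exp (- t)" using 1 n by (intro mult_left_mono) auto
        finally have "7 / 8 * n powr (\<epsilon> / 2) \<le> 7 / 8 * real n * exp (- t)" by simp
        also have "\<dots> \<le> real k * exp (- t)" by (intro mult_right_mono kn') auto
        finally show ?thesis using A1 Z' klnv \<eta>ku uL by linarith
      next
        case 2
        have "(1 - \<epsilon> / 8) * L = \<eta> * ((1 - \<epsilon> / 8) * real n)" unfolding \<eta>_def using n by simp
        also have "\<dots> \<le> \<eta> * real k" using \<eta> kn by (intro mult_left_mono) auto
        finally have "(1 - \<epsilon> / 8) * L * u \<le> \<eta> * real k * u" using u by (intro mult_right_mono) auto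
        then have "2 * u - \<eta> * real k * u \<le> u * (2 - (1 - \<epsilon> / 8) * L)" by (simp add: algebra_simps)
        \<comment> \<open>The coefficient of \<open>u\<close> is nonpositive by \<open>A2\<close>,
          so the threshold value of \<open>u\<close> is the worst one.\<close>
        also have "\<dots> \<le> (1 - 3 * \<epsilon> / 4) * L * (2 - (1 - \<epsilon> / 8) * L)"
          using 2 A2 by (intro mult_right_mono_neg) auto
        finally show ?thesis using A2 Z klnv ke by linarith
      next
        case 3
        have "(1 - 3 * \<epsilon> / 4) * L \<le> L" using \<epsilon> L by simp
        with 3 have uL: "u \<le> L" by linarith
        have d: "1 - \<epsilon> / 2 > 0" using \<epsilon> by simp
        have "u \<le> (1 - 3 * \<epsilon> / 4) * L" using 3 by simp
        also have "\<dots> \<le> (1 - \<epsilon> / 4) * ((1 - \<epsilon> / 2) * L)"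
          using L \<epsilon> by (simp add: algebra_simps)
        also have "\<dots> \<le> (1 - \<epsilon> / 4) * t" using 3 \<epsilon> by (intro mult_left_mono) auto
        finally have "v \<le> 1 - \<epsilon> / 4" unfolding v_def using t by (simp add: field_simps)
        then have "ln v \<le> - (\<epsilon> / 4)" using ln_le_minus_one[OF v(1)] by linarith
        then have "real k * ln v \<le> real k * (- (\<epsilon> / 4))" by (intro mult_left_mono) auto
        also have "\<dots> \<le> 7 / 8 * real n * (- (\<epsilon> / 4))"
          using \<epsilon> kn' by (intro mult_right_mono_neg) auto
        also have "\<dots> = 4 * - (7 / 128 * real n * \<epsilon>)" by simp
        finally have "1 / 4 * (real k * ln v) \<le> - (7 / 128 * real n * \<epsilon>)" by linarith
        then show ?thesis using A3 Z' ke \<eta>ku uL by linarith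
      qed
      with main show ?thesis by simp
    qed
    finally show ?thesis .
  qed
  also have "exp (- 3 * L) = 1 / real n ^ 3"
  proof -
    have "exp (- (3 * L)) = inverse (exp (3 * L))" by (simp add: exp_minus)
    also have "exp (3 * L) = real n ^ 3"
      unfolding L_def using n exp_of_nat_mult[of 3 "ln (real n)"] by simp
    finally show ?thesis by (simp add: inverse_eq_divide)
  qed
  finally have le2: "real (n choose k) ^ 2 * (exp (Z + 2 * u - \<eta> * real k * u - l * t) * (v ^ k * w ^ k))
    \<le> 1 / real n ^ 3" .
  from order_trans[OF le1 le2] show ?thesis unfolding \<eta>_def .
qed

text \<open>The quantifiers over \<open>p\<close>, \<open>k\<close> and \<open>u\<close> stand
  inside the eventuality because one \<open>n\<close> must serve all matching sizes and all points
  of the cube. The estimate \<open>-ln (1 - \<eta>) \<le> \<eta> + 2 \<eta>^2\<close> bounds the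
  exponent of \<open>z powr (- q)\<close> by \<open>(1 - \<epsilon>) * L^2\<close> plus an error of
  at most 1.\<close>

lemma matching_weight_bound:
  fixes \<epsilon> :: real
  assumes \<epsilon>: "0 < \<epsilon>" "\<epsilon> < 1"
  shows "\<forall>\<^sub>F n in sequentially. \<forall>p k u. 0 < p \<and> 9 / 4 * (ln (real n))\<^sup>2 \<le> p * real n \<and> k \<le> n \<and> 0 < u \<longrightarrow>
    real (n choose k) ^ 2 * (1 - ln (real n) / real n) powr (- ((1 - \<epsilon>) * real n * ln (real n))) *
    (exp (u - ln (real n) / real n * real k * u - real (n - k) * (u + p * real (n - k))) *
     ((1 - exp (- (u + p * real (n - k)))) / (u + p * real (n - k))) ^ k * u ^ (k + 1))
    \<le> 1 / real n ^ 3"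
proof -
  have "\<forall>\<^sub>F n::nat in sequentially. ln (real n) / real n \<le> 1 / 2" by real_asymp
  moreover have "\<forall>\<^sub>F n::nat in sequentially. 0 < ln (real n)" by real_asymp
  moreover have "\<forall>\<^sub>F n::nat in sequentially. 2 * (ln (real n)) ^ 3 / real n \<le> 1" by real_asymp
  moreover have "\<forall>\<^sub>F n::nat in sequentially. real n * ln 4 + (ln (real n))\<^sup>2 + 1 - 9 / 4 * (\<epsilon> / 8)\<^sup>2 * (ln (real n))\<^sup>2 * real n \<le> - 3 * ln (real n)"
    using \<epsilon> by real_asymp
  moreover have "\<forall>\<^sub>F n::nat in sequentially. \<epsilon> / 8 * real n \<ge> 2" using \<epsilon> by real_asymp
  moreover have "\<forall>\<^sub>F n::nat in sequentially. (ln (real n))\<^sup>2 + 1 + 2 * ln (real n) - 7 / 8 * real n powr (\<epsilon> / 2) \<le> - 3 * ln (real n)"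
    using \<epsilon> by real_asymp
  moreover have "\<forall>\<^sub>F n::nat in sequentially. 2 \<le> (1 - \<epsilon> / 8) * ln (real n)"
  proof -
    define c where "c = 1 - \<epsilon> / 8"
    have "c > 0" unfolding c_def using \<epsilon> by simp
    then have "\<forall>\<^sub>F n::nat in sequentially. 2 \<le> c * ln (real n)" by real_asymp
    then show ?thesis unfolding c_def .
  qed
  moreover have "\<forall>\<^sub>F n::nat in sequentially. (1 - \<epsilon>) * (ln (real n))\<^sup>2 + 1 + (1 - 3 * \<epsilon> / 4) * ln (real n) * (2 - (1 - \<epsilon> / 8) * ln (real n)) \<le> - 3 * ln (real n)"
  proof -
    \<comment> \<open>This is \<open>(1 - 3 \<epsilon> / 4) (1 - \<epsilon> / 8) - (1 -
      \<epsilon>)\<close>, the net coefficient with which \<open>L^2\<close> is subtracted.\<close>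
    define c where "c = \<epsilon> / 8 + 3 / 32 * \<epsilon>\<^sup>2"
    have "c > 0" unfolding c_def using \<epsilon> by (simp add: add_pos_pos)
    then have "\<forall>\<^sub>F n::nat in sequentially. 1 + 5 * ln (real n) - c * (ln (real n))\<^sup>2 \<le> 0" by real_asymp
    then show ?thesis using \<open>\<forall>\<^sub>F n::nat in sequentially. 0 < ln (real n)\<close>
    proof eventually_elim
      case (elim n)
      have "(1 - \<epsilon>) * (ln (real n))\<^sup>2 + 1 + (1 - 3 * \<epsilon> / 4) * ln (real n) * (2 - (1 - \<epsilon> / 8) * ln (real n))
        = 1 + 2 * (1 - 3 * \<epsilon> / 4) * ln (real n) - c * (ln (real n))\<^sup>2"
        unfolding c_def by (simp add: power2_eq_square field_simps)
      moreover have "2 * (1 - 3 * \<epsilon> / 4) * ln (real n) \<le> 2 * ln (real n)"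
        using \<epsilon> elim by simp
      ultimately show ?case using elim by linarith
    qed
  qed
  moreover have "\<forall>\<^sub>F n::nat in sequentially. (ln (real n))\<^sup>2 + 1 + 2 * ln (real n) - 7 / 128 * real n * \<epsilon> \<le> - 3 * ln (real n)"
    using \<epsilon> by real_asymp
  ultimately show ?thesis
  proof eventually_elim
    case (elim n)
    define L where "L = ln (real n)"
    have "n \<noteq> 0" using elim(2) by (intro notI) simp
    then have n: "real n > 1" using elim(2) by simp
    define \<eta> where "\<eta> = L / real n"
    have \<eta>: "0 < \<eta>" "\<eta> \<le> 1 / 2" unfolding \<eta>_def L_def using elim n by auto
    define Z where "Z = - ((1 - \<epsilon>) * real n * L) * ln (1 - \<eta>)"
    have "- ln (1 - \<eta>) \<le> \<eta> + 2 * \<eta>\<^sup>2"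
      using ln_one_minus_pos_lower_bound[of \<eta>] \<eta> by simp
    then have "(1 - \<epsilon>) * real n * L * (- ln (1 - \<eta>)) \<le> (1 - \<epsilon>) * real n * L * (\<eta> + 2 * \<eta>\<^sup>2)"
      using \<epsilon> elim unfolding L_def by (intro mult_left_mono) auto
    also have "\<dots> = (1 - \<epsilon>) * L\<^sup>2 + (1 - \<epsilon>) * (2 * L ^ 3 / real n)"
      unfolding \<eta>_def using n by (simp add: field_simps power2_eq_square power3_eq_cube)
    also have "\<dots> \<le> (1 - \<epsilon>) * L\<^sup>2 + 1 * 1"
      using \<epsilon> elim unfolding L_def by (intro add_left_mono mult_mono) auto
    finally have Z: "Z \<le> (1 - \<epsilon>) * L\<^sup>2 + 1" unfolding Z_def by simp
    have pw: "(1 - L / real n) powr (- ((1 - \<epsilon>) * real n * L)) = exp Z"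
      unfolding Z_def \<eta>_def powr_def using \<eta> unfolding \<eta>_def by auto
    show ?case
    proof (intro allI impI, elim conjE)
      fix p u :: real and k :: nat
      assume *: "0 < p" "9 / 4 * (ln (real n))\<^sup>2 \<le> p * real n" "k \<le> n" "0 < u"
      show "real (n choose k) ^ 2 * (1 - ln (real n) / real n) powr (- ((1 - \<epsilon>) * real n * ln (real n))) *
        (exp (u - ln (real n) / real n * real k * u - real (n - k) * (u + p * real (n - k))) *
         ((1 - exp (- (u + p * real (n - k)))) / (u + p * real (n - k))) ^ k * u ^ (k + 1))
        \<le> 1 / real n ^ 3"
        using matching_weight_bound_aux[OF \<epsilon> * elim(2) Z[unfolded L_def] elim(4-9)] pw unfolding L_def
        by simp
    qed
  qed
qed

section \<open>The first moment bound\<close>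

text \<open>Listing the values along the sorted domain maps these functions injectively to distinct
  lists. Extensionality prevents counting one matching under several functions.\<close>

lemma card_inj_on_extensional_le:
  fixes D :: "nat set"
  assumes "finite D" "card D \<le> n"
  shows "card {h \<in> D \<rightarrow>\<^sub>E {..<n}. inj_on h D} \<le> (n choose card D) * fact (card D)"
proof -
  define k where "k = card D"
  define xs where "xs = sorted_list_of_set D"
  have xs: "set xs = D" "distinct xs" "length xs = k"
    unfolding xs_def k_def using assms by auto
  let ?H = "{h \<in> D \<rightarrow>\<^sub>E {..<n}. inj_on h D}"
  let ?L = "{ys. length ys = k \<and> distinct ys \<and> set ys \<subseteq> {..<n}}"
  have "card ?H \<le> card ?L"
  proof (rule card_inj_on_le)
    show "inj_on (\<lambda>h. map h xs) ?H"
    proof (rule inj_onI)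
      fix f h assume *: "f \<in> ?H" "h \<in> ?H" "map f xs = map h xs"
      then have "\<And>m. m \<in> D \<Longrightarrow> f m = h m" using xs by (auto simp: map_eq_conv)
      with * show "f = h" by (auto intro: PiE_ext)
    qed
    show "(\<lambda>h. map h xs) ` ?H \<subseteq> ?L"
      using xs by (auto simp: distinct_map PiE_def Pi_def)
    show "finite ?L"
      by (rule finite_subset[OF _ finite_lists_length_eq[of "{..<n}" k]]) auto
  qed
  also have "card ?L = \<Prod>{n - k + 1..n}"
    using card_lists_distinct_length_eq[of "{..<n}" k] assms unfolding k_def by simp
  also have "\<dots> = fact n div fact (n - k)"
    by (simp add: fact_div_fact)
  also have "\<dots> = (n choose k) * fact k"
  proof -
    have "fact n = (n choose k) * fact k * (fact (n - k) :: nat)"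
      using binomial_fact_lemma[of k n] assms unfolding k_def by (simp add: mult_ac)
    then show ?thesis by simp
  qed
  finally show ?thesis unfolding k_def .
qed

lemma sum_over_card:
  fixes f :: "nat \<Rightarrow> real"
  shows "(\<Sum>D\<in>Pow {..<n}. f (card D)) = (\<Sum>k\<le>n. real (n choose k) * f k)"
proof -
  have "(\<Sum>D\<in>Pow {..<n}. f (card D)) = (\<Sum>k\<le>n. \<Sum>D\<in>{D \<in> Pow {..<n}. card D = k}. f (card D))"
    by (rule sum.group[symmetric]) (auto dest: card_mono[OF finite_lessThan])
  also have "\<dots> = (\<Sum>k\<le>n. real (n choose k) * f k)"
  proof (intro sum.cong refl)
    fix k
    have "card {D \<in> Pow {..<n}. card D = k} = n choose k"
      using n_subsets[of "{..<n}" k] by simp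
    then show "(\<Sum>D\<in>{D \<in> Pow {..<n}. card D = k}. f (card D)) = real (n choose k) * f k"
      by simp
  qed
  finally show ?thesis .
qed

lemma set_random_prefs:
  "mp \<in> set_pmf (random_prefs n) \<Longrightarrow> m < n \<Longrightarrow> mp m \<in> permutations_of_set {..<n}"
  unfolding random_prefs_def by (auto simp: set_Pi_pmf PiE_dflt_def)

text \<open>Choosing \<open>h\<close> extensional places it in a finite set of candidates, as the
  union bound requires.\<close>

lemma matching_is_graph:
  assumes "is_matching n I M"
  obtains D h where "D \<subseteq> {..<n}" "h \<in> D \<rightarrow>\<^sub>E {..<n}" "inj_on h D" "M = (\<lambda>m. (m, h m)) ` D"
proof -
  obtain mp wp adm where I: "I = (mp, wp, adm)" by (cases I)
  have sub: "M \<subseteq> {..<n} \<times> {..<n}" using assms unfolding is_matching_def I by auto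
  have uniq: "m = m' \<and> w = w'" if "(m, w) \<in> M" "(m', w') \<in> M" "m = m' \<or> w = w'" for m w m' w'
    using assms that unfolding is_matching_def by blast
  define h where "h = (\<lambda>m\<in>Domain M. SOME w. (m, w) \<in> M)"
  have h: "(m, h m) \<in> M" if "m \<in> Domain M" for m
    unfolding h_def using that by (auto intro: someI)
  show ?thesis
  proof
    show "Domain M \<subseteq> {..<n}" using sub by auto
    show "h \<in> Domain M \<rightarrow>\<^sub>E {..<n}"
      using h sub by (auto simp: PiE_def h_def extensional_def)
    show "inj_on h (Domain M)" using h uniq by (metis inj_onI)
    show "M = (\<lambda>m. (m, h m)) ` Domain M"
    proof (intro equalityI subsetI)
      fix e assume e: "e \<in> M"
      obtain m w where mw: "e = (m, w)" by (cases e)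
      with e have "m \<in> Domain M" by auto
      then show "e \<in> (\<lambda>m. (m, h m)) ` Domain M" using h uniq e mw by blast
    qed (use h in auto)
  qed
qed

text \<open>Union bound over domains \<open>D\<close> and injections \<open>h\<close>. For each size
  \<open>k\<close> the count \<open>(n choose k)^2 * k!\<close> cancels the same quantity in the
  single-matching bound, so each of the \<open>n + 1\<close> sizes contributes the same
  amount.\<close>

lemma prob_cheap_stable_matching_le:
  fixes p \<epsilon> :: real and n :: nat
  defines "z \<equiv> 1 - ln (real n) / real n" and "q \<equiv> (1 - \<epsilon>) * real n * ln (real n)"
  assumes p: "0 < p" "p < 1" and n: "n \<ge> 1" and L: "ln (real n) / real n < 1"
    and bound: "\<And>k u. k \<le> n \<Longrightarrow> 0 < u \<Longrightarrow>
      real (n choose k) ^ 2 * z powr (- q) *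
      (exp (u - ln (real n) / real n * real k * u - real (n - k) * (u + p * real (n - k))) *
       ((1 - exp (- (u + p * real (n - k)))) / (u + p * real (n - k))) ^ k * u ^ (k + 1))
      \<le> 1 / real n ^ 3"
  shows "measure_pmf.prob (random_instance n p) {I. real (min_total_wife_rank n I) < q}
    \<le> exp 2 * real (n + 1) / (real n)\<^sup>2"
proof -
  let ?P = "random_instance n p"
  have z: "0 < z" "z \<le> 1" unfolding z_def using L n by auto
  define E where "E D h = {I. (\<forall>m<n. distinct (fst I m)) \<and> stable_matching n I (candidate_matching.M D h)
      \<and> real (total_wife_rank n I (candidate_matching.M D h)) < q}" for D h
  define H where "H D = {h \<in> D \<rightarrow>\<^sub>E {..<n}. inj_on h D}" for D :: "nat set"
  have finH: "finite (H D)" if "D \<subseteq> {..<n}" for D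
    unfolding H_def using finite_PiE[of D "\<lambda>_. {..<n}"] finite_subset[OF that] by simp
  have prob_E: "measure_pmf.prob ?P (E D h) \<le> exp 2 / (real n ^ 2 * (real (n choose card D) ^ 2 * fact (card D)))"
    if D: "D \<subseteq> {..<n}" and h: "h \<in> H D" for D h
  proof -
    interpret candidate_matching n D h p z
      by unfold_locales (use D h p z in \<open>auto simp: H_def PiE_def Pi_def\<close>)
    define C where "C = real (n choose card D)"
    have C: "C > 0" unfolding C_def using card_D_le by simp
    define Z where "Z = z powr (- q)"
    have Z: "Z > 0" unfolding Z_def using z by simp
    \<comment> \<open>The choice \<open>a = 1 / n\<close> is the largest shift allowed by
      \<open>a * n \<le> 1\<close>; it loses a factor \<open>n\<close>.\<close>
    have "measure_pmf.prob ?P (E D h) \<le> Z * (exp 2 * (1 / (real n ^ 3 * (C\<^sup>2 * Z))) / (fact (card D) * (1 / real n)))"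
      unfolding E_def Z_def
    proof (rule prob_stable_le)
      show "0 < 1 / real n" "1 / real n * real n \<le> 1" using n by auto
      fix u :: real assume u: "0 < u"
      from bound[OF card_D_le u] show "exp (u - (1 - z) * real (card D) * u - l * (u + p * l)) *
        ((1 - exp (- (u + p * l))) / (u + p * l)) ^ card D * u ^ (card D + 1)
        \<le> 1 / (real n ^ 3 * (C\<^sup>2 * z powr - q))"
        unfolding l_def Z_def [symmetric] C_def [symmetric] using C Z n
        by (simp add: z_def field_simps)
    qed
    also have "\<dots> = exp 2 / (real n ^ 2 * (C\<^sup>2 * fact (card D)))"
      using Z C n by (simp add: field_simps power2_eq_square power3_eq_cube)
    finally show ?thesis unfolding C_def .
  qed
  have "measure_pmf.prob ?P {I. real (min_total_wife_rank n I) < q}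
    = measure_pmf.prob ?P ({I. real (min_total_wife_rank n I) < q} \<inter> set_pmf ?P)"
    by (rule measure_Int_set_pmf [symmetric])
  also have "\<dots> \<le> measure_pmf.prob ?P (\<Union>D\<in>Pow {..<n}. \<Union>h\<in>H D. E D h)"
  proof (intro measure_pmf.finite_measure_mono subsetI)
    fix I assume I: "I \<in> {I. real (min_total_wife_rank n I) < q} \<inter> set_pmf ?P"
    obtain mp wp adm where I': "I = (mp, wp, adm)" by (cases I)
    have perm: "\<And>m. m < n \<Longrightarrow> mp m \<in> permutations_of_set {..<n}"
      "\<And>w. w < n \<Longrightarrow> wp w \<in> permutations_of_set {..<n}"
      using I set_random_prefs unfolding I' random_instance_def by auto
    have fin: "finite {M. stable_matching n I M}"
      by (rule finite_subset[of _ "Pow ({..<n} \<times> {..<n})"])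
        (auto simp: stable_matching_def is_matching_def I')
    have "{M. stable_matching n I M} \<noteq> {}" using stable_matching_exists[OF perm] unfolding I' by auto
    then have "min_total_wife_rank n I \<in> total_wife_rank n I ` {M. stable_matching n I M}"
      unfolding min_total_wife_rank_def using fin by (intro Min_in) auto
    then obtain M where M: "stable_matching n I M" "min_total_wife_rank n I = total_wife_rank n I M"
      by auto
    then obtain D h where Dh: "D \<subseteq> {..<n}" "h \<in> D \<rightarrow>\<^sub>E {..<n}" "inj_on h D" "M = (\<lambda>m. (m, h m)) ` D"
      using matching_is_graph unfolding stable_matching_def by metis
    have "candidate_matching n D h p z"
      by unfold_locales (use Dh p z in \<open>auto simp: PiE_def Pi_def\<close>)
    then have "M = candidate_matching.M D h" using Dh(4) by (simp add: candidate_matching.M_def)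
    then have "I \<in> E D h"
      unfolding E_def using M I perm(1) by (auto simp: I' dest: permutations_of_setD)
    then show "I \<in> (\<Union>D\<in>Pow {..<n}. \<Union>h\<in>H D. E D h)"
      using Dh unfolding H_def by blast
  qed auto
  also have "\<dots> \<le> (\<Sum>D\<in>Pow {..<n}. measure_pmf.prob ?P (\<Union>h\<in>H D. E D h))"
    by (rule measure_pmf.finite_measure_subadditive_finite) auto
  also have "\<dots> \<le> (\<Sum>D\<in>Pow {..<n}. exp 2 / ((real n)\<^sup>2 * real (n choose card D)))"
  proof (rule sum_mono)
    fix D assume D: "D \<in> Pow {..<n}"
    define C F :: real where "C = real (n choose card D)" and "F = fact (card D)"
    have k: "card D \<le> n" using D card_mono[of "{..<n}" D] by simp
    have CF: "C > 0" "F > 0" unfolding C_def F_def using k by auto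
    have "measure_pmf.prob ?P (\<Union>h\<in>H D. E D h) \<le> (\<Sum>h\<in>H D. measure_pmf.prob ?P (E D h))"
      using D finH by (intro measure_pmf.finite_measure_subadditive_finite) auto
    also have "\<dots> \<le> (\<Sum>h\<in>H D. exp 2 / (real n ^ 2 * (C ^ 2 * F)))"
      unfolding C_def F_def using D prob_E by (intro sum_mono) auto
    also have "\<dots> = real (card (H D)) * (exp 2 / (real n ^ 2 * (C ^ 2 * F)))" by simp
    also have "\<dots> \<le> real ((n choose card D) * fact (card D)) * (exp 2 / (real n ^ 2 * (C ^ 2 * F)))"
    proof (intro mult_right_mono of_nat_mono)
      show "card (H D) \<le> (n choose card D) * fact (card D)"
        unfolding H_def using D k by (intro card_inj_on_extensional_le) (auto intro: finite_subset)
      show "0 \<le> exp 2 / (real n ^ 2 * (C ^ 2 * F))" using CF by simp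
    qed
    also have "real ((n choose card D) * fact (card D)) = C * F" unfolding C_def F_def by simp
    also have "C * F * (exp 2 / (real n ^ 2 * (C ^ 2 * F))) = exp 2 / ((real n)\<^sup>2 * C)"
      using CF n by (simp add: field_simps power2_eq_square)
    finally show "measure_pmf.prob ?P (\<Union>h\<in>H D. E D h) \<le> exp 2 / ((real n)\<^sup>2 * real (n choose card D))"
      unfolding C_def .
  qed
  also have "\<dots> = (\<Sum>k\<le>n. real (n choose k) * (exp 2 / ((real n)\<^sup>2 * real (n choose k))))"
    by (rule sum_over_card)
  also have "\<dots> = (\<Sum>k\<le>n. exp 2 / (real n)\<^sup>2)"
    by (intro sum.cong refl) simp
  also have "\<dots> = exp 2 * real (n + 1) / (real n)\<^sup>2" by simp
  finally show ?thesis .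
qed

theorem theorem1p7:
  fixes p :: "nat \<Rightarrow> real" and c \<epsilon> :: real
  assumes "\<forall>\<^sub>F n in sequentially. 0 < p n \<and> p n < 1"
    and "c > 9 / 4"
    and "\<forall>\<^sub>F n in sequentially. p n \<ge> c * (ln (real n))\<^sup>2 / real n"
    and "0 < \<epsilon>" and "\<epsilon> < 1"
  shows "(\<lambda>n. measure_pmf.prob (random_instance n (p n))
            {I. real (min_total_wife_rank n I) \<ge> (1 - \<epsilon>) * real n * ln (real n)})
           \<longlonglongrightarrow> 1"
proof -
  let ?good = "\<lambda>n. measure_pmf.prob (random_instance n (p n))
    {I. real (min_total_wife_rank n I) \<ge> (1 - \<epsilon>) * real n * ln (real n)}"
  have "\<forall>\<^sub>F n in sequentially. 1 - exp 2 * real (n + 1) / (real n)\<^sup>2 \<le> ?good n"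
  proof -
    have "\<forall>\<^sub>F n::nat in sequentially. ln (real n) / real n < 1" by real_asymp
    with assms(1,3) matching_weight_bound[OF assms(4,5)] eventually_ge_at_top[of 1]
    show ?thesis
    proof eventually_elim
      case (elim n)
      have "9 / 4 * (ln (real n))\<^sup>2 \<le> c * (ln (real n))\<^sup>2"
        using assms(2) by (intro mult_right_mono) auto
      also have "\<dots> \<le> p n * real n" using elim by (simp add: field_simps)
      finally have pn: "9 / 4 * (ln (real n))\<^sup>2 \<le> p n * real n" .
      have "measure_pmf.prob (random_instance n (p n))
          {I. real (min_total_wife_rank n I) < (1 - \<epsilon>) * real n * ln (real n)}
        \<le> exp 2 * real (n + 1) / (real n)\<^sup>2"
        using elim pn by (intro prob_cheap_stable_matching_le) auto
      moreover have "{I. real (min_total_wife_rank n I) \<ge> (1 - \<epsilon>) * real n * ln (real n)}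
        = UNIV - {I. real (min_total_wife_rank n I) < (1 - \<epsilon>) * real n * ln (real n)}"
        by auto
      ultimately show ?case
        using measure_pmf.prob_compl[of "{I. real (min_total_wife_rank n I) < (1 - \<epsilon>) * real n * ln (real n)}"
            "random_instance n (p n)"] by simp
    qed
  qed
  moreover have "\<forall>\<^sub>F n in sequentially. ?good n \<le> 1" by simp
  moreover have "(\<lambda>n::nat. 1 - exp 2 * real (n + 1) / (real n)\<^sup>2) \<longlonglongrightarrow> 1" by real_asymp
  ultimately show ?thesis
    using tendsto_const by (rule tendsto_sandwich)
qed

end
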